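(* Let $K$ be a field and let $G$ be a finite simple connected graph. If $G$ has neither $K_4$ nor $C_5$ as a minor, then the cut ideal $I_G$ has a quadratic Gröbner basis (that is, there is a monomial order with respect to which $I_G$ has a Gröbner basis consisting of quadratic binomials).
   Context: Let $G$ be a finite simple graph with vertex set $V(G)$ and edge set $E(G)$. For each unordered partition $A|B$ of $V(G)$ (that is, $A\cap B=\emptyset$, $A\cup B=V(G)$, possibly with $A$ or $B$ empty, and $A|B=B|A$) take a variable $q_{A|B}$, and let $K[q]$ be the polynomial ring over $K$ in these $2^{|V(G)|-1}$ variables. Let $K[s,T]=K[s,t_{ij}\mid ij\in E(G)]$. Define the $K$-algebra homomorphism $\pi_G:K[q]\to K[s,T]$ by $\pi_G(q_{A|B})=s\cdot\prod_{ij\in E(G),\ |A\cap\{i,j\}|=1}t_{ij}$. The cut ideal $I_G$ is $\ker\pi_G$. The zero ideal is regarded as having a (trivial, empty) quadratic Gröbner basis. $K_4$ is the complete graph on 4 vertices and $C_5$ is the cycle of length 5. A graph $H$ is a minor of $G$ if (up to isomorphism) $H$ can be obtained from $G$ by deleting and contracting edges (after a contraction, loops are removed and parallel edges are identified). *)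

theory Defs
  imports "HOL-Algebra.Ideal" "HOL-Algebra.RingHom" "HOL-Library.Poly_Mapping"
begin

section \<open>Finite simple graphs and minors\<close>

record 'v sgraph =
  verts :: "'v set"
  edges :: "'v set set"

definition simple_graph :: "'v sgraph \<Rightarrow> bool" where
  "simple_graph G \<longleftrightarrow> finite (verts G) \<and> (\<forall>e\<in>edges G. e \<subseteq> verts G \<and> card e = 2)"

definition connected_graph :: "'v sgraph \<Rightarrow> bool" where
  "connected_graph G \<longleftrightarrow> verts G \<noteq> {} \<and>
     (\<forall>u\<in>verts G. \<forall>v\<in>verts G. (u, v) \<in> {(x, y). {x, y} \<in> edges G}\<^sup>*)"

definition complete_graph :: "nat \<Rightarrow> nat sgraph" where
  "complete_graph n = \<lparr>verts = {..<n}, edges = {e. e \<subseteq> {..<n} \<and> card e = 2}\<rparr>"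

text \<open>The cycle of length \<open>n\<close>, for \<open>n \<ge> 3\<close>.\<close>

definition cycle_graph :: "nat \<Rightarrow> nat sgraph" where
  "cycle_graph n = \<lparr>verts = {..<n}, edges = {{i, (i + 1) mod n} |i. i < n}\<rparr>"

definition graph_iso :: "'v sgraph \<Rightarrow> 'w sgraph \<Rightarrow> bool" where
  "graph_iso G H \<longleftrightarrow> (\<exists>f. bij_betw f (verts G) (verts H) \<and> edges H = (\<lambda>e. f ` e) ` edges G)"

definition delete_edge :: "'v set \<Rightarrow> 'v sgraph \<Rightarrow> 'v sgraph" where
  "delete_edge e G = G\<lparr>edges := edges G - {e}\<rparr>"

text \<open>Contraction of the edge \<open>{u, v}\<close>, where \<open>v\<close> is merged into \<open>u\<close>. The condition on the
  cardinality removes loops; parallel edges are identified because edges form a set.\<close>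

definition contract_edge :: "'v \<Rightarrow> 'v \<Rightarrow> 'v sgraph \<Rightarrow> 'v sgraph" where
  "contract_edge u v G =
     \<lparr>verts = verts G - {v}, edges = {e' \<in> (\<lambda>e. id(v := u) ` e) ` edges G. card e' = 2}\<rparr>"

inductive minor_step :: "'v sgraph \<Rightarrow> 'v sgraph \<Rightarrow> bool" where
  delete: "e \<in> edges G \<Longrightarrow> minor_step G (delete_edge e G)"
| contract: "{u, v} \<in> edges G \<Longrightarrow> minor_step G (contract_edge u v G)"

definition is_minor :: "'w sgraph \<Rightarrow> 'v sgraph \<Rightarrow> bool" where
  "is_minor H G \<longleftrightarrow> (\<exists>G'. minor_step\<^sup>*\<^sup>* G G' \<and> graph_iso G' H)"


section \<open>Polynomial rings in a set of variables\<close>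

text \<open>A polynomial is a finitely supported function from exponent vectors to coefficients; its
  multiplication is the convolution product of the type \<open>_ \<Rightarrow>\<^sub>0 _\<close>.\<close>

type_synonym 'x monomial = "'x \<Rightarrow>\<^sub>0 nat"
type_synonym ('x, 'k) mpoly = "'x monomial \<Rightarrow>\<^sub>0 'k"

definition monomials :: "'x set \<Rightarrow> 'x monomial set" where
  "monomials X = {m. Poly_Mapping.keys m \<subseteq> X}"

definition mpoly_ring :: "'x set \<Rightarrow> ('x, 'k::field) mpoly ring" where
  "mpoly_ring X = \<lparr>carrier = {p. Poly_Mapping.keys p \<subseteq> monomials X}, mult = (*), one = 1, zero = 0, add = (+)\<rparr>"

lemma monomials_zero: "0 \<in> monomials X"
  by (simp add: monomials_def)

lemma monomials_add: "m \<in> monomials X \<Longrightarrow> n \<in> monomials X \<Longrightarrow> m + n \<in> monomials X"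
  using Poly_Mapping.keys_add[of m n] by (auto simp: monomials_def)

lemma cring_mpoly_ring: "cring (mpoly_ring X :: ('x, 'k::field) mpoly ring)"
  (is "cring ?R")
proof (rule cringI)
  show "abelian_group ?R"
  proof (rule abelian_groupI)
    fix p :: "('x, 'k) mpoly" assume "p \<in> carrier ?R"
    then show "\<exists>q\<in>carrier ?R. q \<oplus>\<^bsub>?R\<^esub> p = \<zero>\<^bsub>?R\<^esub>"
      by (intro bexI[of _ "- p"]) (auto simp: mpoly_ring_def)
  qed (use Poly_Mapping.keys_add in \<open>fastforce simp: mpoly_ring_def add_ac\<close>)+
  show "Group.comm_monoid ?R"
  proof (rule comm_monoidI)
    fix p q :: "('x, 'k) mpoly"
    assume "p \<in> carrier ?R" "q \<in> carrier ?R"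
    then show "p \<otimes>\<^bsub>?R\<^esub> q \<in> carrier ?R"
      using Poly_Mapping.keys_mult[of p q] monomials_add by (fastforce simp: mpoly_ring_def)
  qed (auto simp: mpoly_ring_def mult_ac monomials_zero)
qed (simp add: mpoly_ring_def distrib_right)

definition mpoly_var :: "'x \<Rightarrow> ('x, 'k::field) mpoly" where
  "mpoly_var x = Poly_Mapping.single (Poly_Mapping.single x 1) 1"

text \<open>\<open>mpoly_subst \<phi>\<close> is the \<open>K\<close>-algebra homomorphism that sends each variable \<open>x\<close> to \<open>\<phi> x\<close>.\<close>

definition mpoly_subst :: "('x \<Rightarrow> ('y, 'k::field) mpoly) \<Rightarrow> ('x, 'k) mpoly \<Rightarrow> ('y, 'k) mpoly" where
  "mpoly_subst \<phi> p =
     (\<Sum>m\<in>Poly_Mapping.keys p. Poly_Mapping.single 0 (Poly_Mapping.lookup p m) *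
        (\<Prod>x\<in>Poly_Mapping.keys m. \<phi> x ^ Poly_Mapping.lookup m x))"


section \<open>Groebner bases\<close>

text \<open>\<open>(m, n) \<in> r\<close> means \<open>m \<le> n\<close>. For finite \<open>X\<close> such an order is a well-order by Dickson's lemma.\<close>

definition monomial_order :: "'x set \<Rightarrow> 'x monomial rel \<Rightarrow> bool" where
  "monomial_order X r \<longleftrightarrow>
     linear_order_on (monomials X) r \<and>
     (\<forall>m\<in>monomials X. (0, m) \<in> r) \<and>
     (\<forall>m n. \<forall>k\<in>monomials X. (m, n) \<in> r \<longrightarrow> (m + k, n + k) \<in> r)"

text \<open>The initial monomial, as a polynomial with coefficient \<open>1\<close>; meaningful for \<open>p \<noteq> 0\<close>.\<close>

definition initial_monomial :: "'x monomial rel \<Rightarrow> ('x, 'k::field) mpoly \<Rightarrow> ('x, 'k) mpoly" where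
  "initial_monomial r p =
     Poly_Mapping.single (THE m. m \<in> Poly_Mapping.keys p \<and> (\<forall>n\<in>Poly_Mapping.keys p. (n, m) \<in> r)) 1"

definition initial_ideal :: "'x set \<Rightarrow> 'x monomial rel \<Rightarrow> ('x, 'k::field) mpoly set \<Rightarrow> ('x, 'k) mpoly set"
  where "initial_ideal X r S = Idl\<^bsub>mpoly_ring X\<^esub> (initial_monomial r ` (S - {0}))"

definition groebner_basis ::
    "'x set \<Rightarrow> 'x monomial rel \<Rightarrow> ('x, 'k::field) mpoly set \<Rightarrow> ('x, 'k) mpoly set \<Rightarrow> bool" where
  "groebner_basis X r I B \<longleftrightarrow> finite B \<and> B \<subseteq> I \<and> initial_ideal X r B = initial_ideal X r I"

definition monomial_degree :: "'x monomial \<Rightarrow> nat" where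
  "monomial_degree m = (\<Sum>x\<in>Poly_Mapping.keys m. Poly_Mapping.lookup m x)"

definition quadratic_binomial :: "('x, 'k::field) mpoly \<Rightarrow> bool" where
  "quadratic_binomial p \<longleftrightarrow>
     (\<exists>m n. m \<noteq> n \<and> monomial_degree m = 2 \<and> monomial_degree n = 2 \<and>
            p = Poly_Mapping.single m 1 - Poly_Mapping.single n 1)"


section \<open>Cut ideals\<close>

text \<open>The unordered partition \<open>A|B\<close> is the set \<open>{A, B}\<close>, and it serves as the index of the
  variable \<open>q\<^sub>A\<^sub>|\<^sub>B\<close>.\<close>

definition cuts :: "'v sgraph \<Rightarrow> 'v set set set" where
  "cuts G = {{A, B} |A B. A \<inter> B = {} \<and> A \<union> B = verts G}"

text \<open>For an edge \<open>e\<close> and a partition \<open>A|B\<close>, the sets \<open>A \<inter> e\<close> and \<open>B \<inter> e\<close> have one element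
  each or neither has, so the quantifier over the two parts expresses \<open>|A \<inter> e| = 1\<close>.\<close>

definition cut_edges :: "'v sgraph \<Rightarrow> 'v set set \<Rightarrow> 'v set set" where
  "cut_edges G P = {e \<in> edges G. \<exists>A\<in>P. card (A \<inter> e) = 1}"

datatype 'v st_var = s_var | t_var "'v set"

definition st_vars :: "'v sgraph \<Rightarrow> 'v st_var set" where
  "st_vars G = insert s_var (t_var ` edges G)"

definition cut_hom :: "'v sgraph \<Rightarrow> ('v set set, 'k::field) mpoly \<Rightarrow> ('v st_var, 'k) mpoly" where
  "cut_hom G = mpoly_subst (\<lambda>P. mpoly_var s_var * (\<Prod>e\<in>cut_edges G P. mpoly_var (t_var e)))"

definition cut_ideal :: "'v sgraph \<Rightarrow> ('v set set, 'k::field) mpoly set" where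
  "cut_ideal G = a_kernel (mpoly_ring (cuts G)) (mpoly_ring (st_vars G)) (cut_hom G)"

end

(* The proof is by standard monomials. A graph without a K4 or C5 minor has no cycle of length at least 5,
   so it is glued at cut vertices from single edges and from graphs K_{2,n}, K_{1,1,n}. The toric ring of a
   gluing at a vertex is the Segre product of the toric rings of the two parts, and quadratic Groebner
   bases pass to Segre products by adding the sorting relations. For the basic graphs with poles a and b,
   the cuts form two Boolean lattices, according to whether they separate a from b. The straightening
   relations S, T -> S Int T, S Un T in each lattice, together with one relation between the two lattices
   when a and b are not adjacent, leave a single standard monomial in each fibre. *)

theory Submission
  imports Defs "HOL-Library.Multiset" "HOL-Library.Infinite_Set"
    "HOL-Computational_Algebra.Primes"
begin

section \<open>Quadratic straightening\<close>

text \<open>Weights, not term orders, carry the argument because they combine: the weights of two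
  glued parts add up to a weight on pairs. Only strict drops of weight count as moves, so at the end
  ties may be broken by any multiplicative order. The abstract relation \<open>R\<close> separates
  the combinatorics of multisets from the polynomials, which return only through the kernel property
  that no monomial of an element is alone in its fibre. Cuts are encoded by rooted sets so that
  uncrossing becomes intersection and union, and so that a glue vertex can be the common root of
  both parts. The obstacle in a block without the edge \<open>ab\<close> is that a fibre does not
  show how many cuts separate the poles; the extra relation is what makes this number recoverable.
  The obstacle in the graph theory is the choice of poles: a 4-cycle has two pairs of opposite
  vertices, and a bad pair leaves vertices outside the book or edges between its pages.
  \<open>K_4\<close> has to be excluded by itself, since four vertices carry no cycle of length
  five.\<close>

definition quad_reducible :: "'x set \<Rightarrow> ('x multiset \<Rightarrow> 'x multiset \<Rightarrow> bool) \<Rightarrow> ('x \<Rightarrow> nat) \<Rightarrow> 'x multiset \<Rightarrow> bool"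
  where "quad_reducible X R w M \<longleftrightarrow>
    (\<exists>a b c d. {#a, b#} \<subseteq># M \<and> c \<in> X \<and> d \<in> X \<and> R {#a, b#} {#c, d#} \<and> w c + w d < w a + w b)"

text \<open>A monomial in the variables \<open>X\<close> is written as a multiset over \<open>X\<close>, and \<open>R\<close> stands for "same image under
  the toric homomorphism". A quadratic move replaces two factors by an \<open>R\<close>-equivalent pair of smaller
  weight; the condition below says that a fibre contains at most one monomial without such a move.
  That is the standard-monomial criterion for the binomials of these moves to be a Groebner basis.\<close>

definition quad_confluent :: "'x set \<Rightarrow> ('x multiset \<Rightarrow> 'x multiset \<Rightarrow> bool) \<Rightarrow> bool" where
  "quad_confluent X R \<longleftrightarrow>
    (\<exists>w. \<forall>M N. set_mset M \<subseteq> X \<longrightarrow> set_mset N \<subseteq> X \<longrightarrow> R M N \<longrightarrow> M \<noteq> N \<longrightarrow>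
       quad_reducible X R w M \<or> quad_reducible X R w N)"

lemma quad_confluentE:
  assumes "quad_confluent X R"
  obtains w where "\<And>M N. \<lbrakk>set_mset M \<subseteq> X; set_mset N \<subseteq> X; R M N; \<not> quad_reducible X R w M;
      \<not> quad_reducible X R w N\<rbrakk> \<Longrightarrow> M = N"
  using assms unfolding quad_confluent_def by blast

lemma quad_confluentI:
  assumes "\<And>M N. \<lbrakk>set_mset M \<subseteq> X; set_mset N \<subseteq> X; R M N; \<not> quad_reducible X R w M;
      \<not> quad_reducible X R w N\<rbrakk> \<Longrightarrow> M = N"
  shows "quad_confluent X R"
  using assms unfolding quad_confluent_def by blast

lemma quad_reducibleI:
  "\<lbrakk>{#a, b#} \<subseteq># M; c \<in> X; d \<in> X; R {#a, b#} {#c, d#}; w c + w d < w a + w b\<rbrakk> \<Longrightarrow> quad_reducible X R w M"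
  unfolding quad_reducible_def by blast

lemma pair_subseteq_image_mset:
  assumes "{#a, b#} \<subseteq># image_mset f M"
  obtains a' b' where "{#a', b'#} \<subseteq># M" "f a' = a" "f b' = b"
proof -
  obtain K where "image_mset f M = add_mset a (add_mset b K)"
    using assms by (auto simp: subset_mset.le_iff_add)
  then obtain N a' where M: "M = add_mset a' N" "f a' = a" "image_mset f N = add_mset b K"
    by (metis msed_map_invR)
  then obtain L b' where "N = add_mset b' L" "f b' = b"
    by (metis msed_map_invR)
  with M show ?thesis
    by (intro that[of a' b']) auto
qed

lemma pair_subseteq_mset:
  assumes "a \<in># M" "b \<in># M" "a \<noteq> b"
  shows "{#a, b#} \<subseteq># M"
  using assms by (metis insert_DiffM insert_noteq_member mset_subset_eq_add_mset_cancel single_subset_iff)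

lemma image_mset_inj_on:
  assumes "inj_on f X" "set_mset M \<subseteq> X" "set_mset N \<subseteq> X" "image_mset f M = image_mset f N"
  shows "M = N"
proof -
  have "image_mset (inv_into X f) (image_mset f P) = P" if "set_mset P \<subseteq> X" for P
  proof -
    have "image_mset (inv_into X f) (image_mset f P) = image_mset (\<lambda>x. x) P"
      unfolding multiset.map_comp
      by (rule image_mset_cong) (use that assms(1) in \<open>auto intro: inv_into_f_f\<close>)
    then show ?thesis by simp
  qed
  then show ?thesis
    using assms by metis
qed

text \<open>Weights pull back along a renaming of the variables, and moves lift with them. This
  serves to split a cut at a glue vertex, to change the root, and to pass from rooted sets to
  unordered partitions.\<close>

lemma quad_confluent_bij:
  assumes "quad_confluent X R" "bij_betw g Y X"
    and R: "\<And>M N. \<lbrakk>set_mset M \<subseteq> Y; set_mset N \<subseteq> Y\<rbrakk> \<Longrightarrow> R' M N \<longleftrightarrow> R (image_mset g M) (image_mset g N)"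
  shows "quad_confluent Y R'"
proof -
  obtain w where w: "\<And>M N. \<lbrakk>set_mset M \<subseteq> X; set_mset N \<subseteq> X; R M N; \<not> quad_reducible X R w M;
      \<not> quad_reducible X R w N\<rbrakk> \<Longrightarrow> M = N"
    using assms(1) by (rule quad_confluentE) blast
  have g: "inj_on g Y" "g ` Y = X"
    using assms(2) by (auto simp: bij_betw_def)
  have red: "quad_reducible Y R' (w \<circ> g) M"
    if "quad_reducible X R w (image_mset g M)" "set_mset M \<subseteq> Y" for M
  proof -
    obtain a b c d where abcd: "{#a, b#} \<subseteq># image_mset g M" "c \<in> X" "d \<in> X" "R {#a, b#} {#c, d#}"
        "w c + w d < w a + w b"
      using \<open>quad_reducible X R w (image_mset g M)\<close> unfolding quad_reducible_def by blast
    obtain a' b' where a'b': "{#a', b'#} \<subseteq># M" "g a' = a" "g b' = b"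
      using pair_subseteq_image_mset[OF abcd(1)] .
    have "a' \<in> Y" "b' \<in> Y"
      using a'b' that(2) by (auto dest!: set_mset_mono)
    moreover obtain c' d' where "c' \<in> Y" "d' \<in> Y" "g c' = c" "g d' = d"
      using abcd g by blast
    ultimately show ?thesis
      using abcd a'b' by (intro quad_reducibleI[of a' b' M c' _ d']) (auto simp: R)
  qed
  show ?thesis
  proof (rule quad_confluentI[of Y R' "w \<circ> g"])
    fix M N
    assume MN: "set_mset M \<subseteq> Y" "set_mset N \<subseteq> Y" "R' M N"
      and "\<not> quad_reducible Y R' (w \<circ> g) M" "\<not> quad_reducible Y R' (w \<circ> g) N"
    then have "\<not> quad_reducible X R w (image_mset g M)" "\<not> quad_reducible X R w (image_mset g N)"
      using red by auto
    moreover have "set_mset (image_mset g M) \<subseteq> X" "set_mset (image_mset g N) \<subseteq> X"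
      using MN g by auto
    ultimately have "image_mset g M = image_mset g N"
      using w[of "image_mset g M" "image_mset g N"] R MN by blast
    then show "M = N"
      using image_mset_inj_on[OF g(1)] MN by blast
  qed
qed

text \<open>A sorted pairing is determined by its marginals: the pair of both minima must occur, and
  removing it leaves a smaller instance. Injectivity of \<open>p\<close> and \<open>q\<close> turns
  minimal values back into elements.\<close>

lemma comonotone_mset_eq:
  fixes p :: "'x \<Rightarrow> nat" and q :: "'y \<Rightarrow> nat"
  assumes "inj_on p X" "inj_on q Y" "set_mset M \<subseteq> X \<times> Y" "set_mset N \<subseteq> X \<times> Y"
    and "\<And>x y x' y'. \<lbrakk>(x, y) \<in># M; (x', y') \<in># M; p x < p x'\<rbrakk> \<Longrightarrow> q y \<le> q y'"
    and "\<And>x y x' y'. \<lbrakk>(x, y) \<in># N; (x', y') \<in># N; p x < p x'\<rbrakk> \<Longrightarrow> q y \<le> q y'"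
    and "image_mset fst M = image_mset fst N" "image_mset snd M = image_mset snd N"
  shows "M = N"
  using assms(3-)
proof (induction "size M" arbitrary: M N)
  case 0
  then show ?case by auto
next
  case (Suc n)
  define i where "i = Min (p ` fst ` set_mset M)"
  define j where "j = Min (q ` snd ` set_mset M)"
  have ne: "set_mset M \<noteq> {}"
    using Suc by auto
  have fs: "fst ` set_mset M = fst ` set_mset N" "snd ` set_mset M = snd ` set_mset N"
    using Suc.prems(5,6) by (metis set_image_mset)+
  \<comment> \<open>Take a pair with minimal first and a pair with minimal second coordinate. If the
    latter has the larger first coordinate, sortedness makes the former minimal in both; otherwise
    the latter is.\<close>
  have least: "\<exists>x y. (x, y) \<in># P \<and> p x = i \<and> q y = j"
    if P: "fst ` set_mset P = fst ` set_mset M" "snd ` set_mset P = snd ` set_mset M"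
      and mono: "\<And>x y x' y'. \<lbrakk>(x, y) \<in># P; (x', y') \<in># P; p x < p x'\<rbrakk> \<Longrightarrow> q y \<le> q y'" for P
  proof -
    have "i \<in> p ` fst ` set_mset P" "j \<in> q ` snd ` set_mset P"
      unfolding i_def j_def P using ne by (intro Min_in; simp)+
    then obtain x y x' y' where *: "(x, y) \<in># P" "p x = i" "(x', y') \<in># P" "q y' = j"
      by fastforce
    have "i \<le> p x'" "j \<le> q y"
      unfolding i_def j_def P[symmetric] using * by (intro Min_le; force)+
    then show ?thesis
      using mono[of x y x' y'] * by (metis le_antisym le_neq_implies_less)
  qed
  obtain x y where xy: "(x, y) \<in># M" "p x = i" "q y = j"
    using least[of M] Suc.prems(3) by blast
  obtain x' y' where xy': "(x', y') \<in># N" "p x' = i" "q y' = j"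
    using least[of N] Suc.prems(4) fs by metis
  have "x' = x" "y' = y"
    using xy xy' Suc.prems(1,2) assms(1,2) by (auto dest!: inj_onD subsetD)
  then obtain M' N' where MN: "M = add_mset (x, y) M'" "N = add_mset (x, y) N'"
    using xy xy' by (metis insert_DiffM)
  have "q y1 \<le> q y2" if "(x1, y1) \<in># M'" "(x2, y2) \<in># M'" "p x1 < p x2" for x1 y1 x2 y2
    using Suc.prems(3)[of x1 y1 x2 y2] that by (simp add: MN)
  moreover have "q y1 \<le> q y2" if "(x1, y1) \<in># N'" "(x2, y2) \<in># N'" "p x1 < p x2" for x1 y1 x2 y2
    using Suc.prems(4)[of x1 y1 x2 y2] that by (simp add: MN)
  ultimately have "M' = N'"
    using Suc.prems(1,2,5,6) Suc.hyps(2) by (intro Suc.hyps(1)) (auto simp: MN)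
  then show ?case by (simp add: MN)
qed

text \<open>A move of one factor lifts by keeping the other coordinates, which is where reflexivity
  of \<open>R\<close> and \<open>S\<close> enters. Hence irreducible monomials have irreducible
  projections; these are unique in a fibre, and sortedness then fixes the pairing.\<close>

lemma quad_confluent_Times:
  assumes "quad_confluent X R" "quad_confluent Y S" "finite X" "finite Y" "\<And>M. R M M" "\<And>M. S M M"
  shows "quad_confluent (X \<times> Y)
    (\<lambda>M N. R (image_mset fst M) (image_mset fst N) \<and> S (image_mset snd M) (image_mset snd N))"
    (is "quad_confluent ?Z ?T")
proof -
  obtain u where u: "\<And>M N. \<lbrakk>set_mset M \<subseteq> X; set_mset N \<subseteq> X; R M N; \<not> quad_reducible X R u M;
      \<not> quad_reducible X R u N\<rbrakk> \<Longrightarrow> M = N"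
    using assms(1) by (rule quad_confluentE) blast
  obtain v where v: "\<And>M N. \<lbrakk>set_mset M \<subseteq> Y; set_mset N \<subseteq> Y; S M N; \<not> quad_reducible Y S v M;
      \<not> quad_reducible Y S v N\<rbrakk> \<Longrightarrow> M = N"
    using assms(2) by (rule quad_confluentE) blast
  obtain p :: "'a \<Rightarrow> nat" and q :: "'b \<Rightarrow> nat" where pq: "inj_on p X" "inj_on q Y"
    using assms(3,4) finite_imp_inj_to_nat_seg by metis
  obtain C where C: "\<And>x y. \<lbrakk>x \<in> X; y \<in> Y\<rbrakk> \<Longrightarrow> p x * q y \<le> C"
  proof
    show "p x * q y \<le> Max ((\<lambda>(x, y). p x * q y) ` (X \<times> Y))" if "x \<in> X" "y \<in> Y" for x y
      using that assms(3,4) by (intro Max_ge) auto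
  qed
  \<comment> \<open>The main term inherits the moves of both factors. The correction \<open>C - p x * q y\<close> is too small to
    interfere with it and makes the Segre moves \<open>(x, y) (x', y') \<rightarrow> (x, y') (x', y)\<close> sort
    pairs: by rearrangement, sorted pairs maximise the sum of the products.\<close>
  define w where "w = (\<lambda>(x, y). (2 * C + 1) * (u x + v y) + (C - p x * q y))"
  have w_less: "w (x, y) + w (x', y') < w (a, b) + w (a', b')"
    \<comment> \<open>A pair carries two corrections, at most \<open>2 * C\<close> together; hence
      the factor \<open>2 * C + 1\<close> of the main term.\<close>
    if "u x + v y + (u x' + v y') < u a + v b + (u a' + v b')" for x y x' y' a b a' b'
  proof -
    let ?U = "u x + v y + (u x' + v y')" and ?A = "u a + v b + (u a' + v b')"
    have "w (x, y) + w (x', y') \<le> (2 * C + 1) * ?U + 2 * C"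
      by (auto simp: w_def algebra_simps)
    also have "\<dots> < (2 * C + 1) * Suc ?U"
      by simp
    also have "\<dots> \<le> (2 * C + 1) * ?A"
      using that by (intro mult_le_mono) auto
    also have "\<dots> \<le> w (a, b) + w (a', b')"
      by (auto simp: w_def algebra_simps)
    finally show ?thesis .
  qed
  have irred: "\<not> quad_reducible X R u (image_mset fst M) \<and> \<not> quad_reducible Y S v (image_mset snd M) \<and>
      (\<forall>x y x' y'. (x, y) \<in># M \<longrightarrow> (x', y') \<in># M \<longrightarrow> p x < p x' \<longrightarrow> q y \<le> q y')"
    if M: "set_mset M \<subseteq> ?Z" and nr: "\<not> quad_reducible ?Z ?T w M" for M
  proof (intro conjI allI impI)
    show "\<not> quad_reducible X R u (image_mset fst M)"
    proof
      assume "quad_reducible X R u (image_mset fst M)"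
      then obtain a b c d where abcd: "{#a, b#} \<subseteq># image_mset fst M" "c \<in> X" "d \<in> X"
          "R {#a, b#} {#c, d#}" "u c + u d < u a + u b"
        unfolding quad_reducible_def by blast
      then obtain y z where yz: "{#(a, y), (b, z)#} \<subseteq># M"
        by (metis pair_subseteq_image_mset prod.collapse)
      then have "y \<in> Y" "z \<in> Y"
        using M by (auto dest!: set_mset_mono)
      then have "quad_reducible ?Z ?T w M"
        using abcd yz assms(6)[of "{#y, z#}"] by (intro quad_reducibleI[of "(a, y)"
            "(b, z)" M "(c, y)" _ "(d, z)"] w_less) auto
      then show False using nr by blast
    qed
    show "\<not> quad_reducible Y S v (image_mset snd M)"
    proof
      assume "quad_reducible Y S v (image_mset snd M)"
      then obtain a b c d where abcd: "{#a, b#} \<subseteq># image_mset snd M" "c \<in> Y" "d \<in> Y"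
          "S {#a, b#} {#c, d#}" "v c + v d < v a + v b"
        unfolding quad_reducible_def by blast
      then obtain y z where yz: "{#(y, a), (z, b)#} \<subseteq># M"
        by (metis pair_subseteq_image_mset prod.collapse)
      then have "y \<in> X" "z \<in> X"
        using M by (auto dest!: set_mset_mono)
      then have "quad_reducible ?Z ?T w M"
        using abcd yz assms(5)[of "{#y, z#}"] by (intro quad_reducibleI[of "(y, a)"
            "(z, b)" M "(y, c)" _ "(z, d)"] w_less) auto
      then show False using nr by blast
    qed
    fix x y x' y'
    assume xy: "(x, y) \<in># M" "(x', y') \<in># M" "p x < p x'"
    show "q y \<le> q y'"
    proof (rule ccontr)
      assume "\<not> q y \<le> q y'"
      then have "q y' < q y" by simp
      \<comment> \<open>The two sums of products compared below differ by
        \<open>Suc i * Suc j\<close>.\<close>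
      obtain i j where ij: "p x' = p x + Suc i" "q y = q y' + Suc j"
        using \<open>p x < p x'\<close> \<open>q y' < q y\<close> by (metis less_iff_Suc_add add_Suc_right)
      have in_Z: "x \<in> X" "y \<in> Y" "x' \<in> X" "y' \<in> Y"
        using xy M by auto
      have "p x * q y' + p x' * q y > p x * q y + p x' * q y'"
        by (simp add: ij algebra_simps)
      then have "w (x, y') + w (x', y) < w (x, y) + w (x', y')"
        using C[of x y'] C[of x' y] C[of x y] C[of x' y'] in_Z by (simp add: w_def algebra_simps)
      moreover have "{#(x, y), (x', y')#} \<subseteq># M"
        using xy by (intro pair_subseteq_mset) auto
      moreover have "?T {#(x, y), (x', y')#} {#(x, y'), (x', y)#}"
        using assms(5)[of "{#x, x'#}"] assms(6)[of "{#y, y'#}"] by (simp add: add_mset_commute)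
      ultimately have "quad_reducible ?Z ?T w M"
        using in_Z by (intro quad_reducibleI[of "(x, y)" "(x', y')" M "(x, y')" _ "(x', y)"]) auto
      then show False using nr by blast
    qed
  qed
  show ?thesis
  proof (rule quad_confluentI[of ?Z ?T w])
    fix M N
    assume M: "set_mset M \<subseteq> ?Z" "\<not> quad_reducible ?Z ?T w M"
      and N: "set_mset N \<subseteq> ?Z" "\<not> quad_reducible ?Z ?T w N"
      and T: "?T M N"
    note irred = irred[OF M] irred[OF N]
    have "image_mset fst M = image_mset fst N" "image_mset snd M = image_mset snd N"
      using irred T M(1) N(1) by (intro u v; auto)+
    then show "M = N"
      using irred M(1) N(1) by (intro comonotone_mset_eq[OF pq]) blast+
  qed
qed

section \<open>From straightening to Groebner bases\<close>

definition mset_of :: "'x monomial \<Rightarrow> 'x multiset" where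
  "mset_of m = Abs_multiset (Poly_Mapping.lookup m)"

definition monomial_of :: "'x multiset \<Rightarrow> 'x monomial" where
  "monomial_of M = (\<Sum>x\<in>#M. Poly_Mapping.single x 1)"

lemma count_mset_of: "count (mset_of m) x = Poly_Mapping.lookup m x"
  by (simp add: mset_of_def count_Abs_multiset)

lemma lookup_monomial_of: "Poly_Mapping.lookup (monomial_of M) x = count M x"
  by (induction M) (auto simp: monomial_of_def lookup_add lookup_single)

lemma mset_of_monomial_of [simp]: "mset_of (monomial_of M) = M"
  by (rule multiset_eqI) (simp add: count_mset_of lookup_monomial_of)

lemma monomial_of_mset_of [simp]: "monomial_of (mset_of m) = m"
  by (rule poly_mapping_eqI) (simp add: count_mset_of lookup_monomial_of)

lemma mset_of_eq_iff: "mset_of m = mset_of n \<longleftrightarrow> m = n"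
  by (metis monomial_of_mset_of)

lemma monomial_of_eq_iff: "monomial_of M = monomial_of N \<longleftrightarrow> M = N"
  by (metis mset_of_monomial_of)

lemma mset_of_add: "mset_of (m + n) = mset_of m + mset_of n"
  by (rule multiset_eqI) (simp add: count_mset_of lookup_add)

lemma mset_of_0 [simp]: "mset_of 0 = {#}"
  by (rule multiset_eqI) (simp add: count_mset_of)

lemma monomial_of_add: "monomial_of (M + N) = monomial_of M + monomial_of N"
  by (simp add: monomial_of_def)

lemma set_mset_of: "set_mset (mset_of m) = Poly_Mapping.keys m"
  by (auto simp: set_mset_def count_mset_of in_keys_iff)

lemma monomials_iff: "m \<in> monomials X \<longleftrightarrow> set_mset (mset_of m) \<subseteq> X"
  by (simp add: monomials_def set_mset_of)

lemma monomial_of_in_monomials: "monomial_of M \<in> monomials X \<longleftrightarrow> set_mset M \<subseteq> X"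
  by (simp add: monomials_iff)

lemma monomial_degree_monomial_of: "monomial_degree (monomial_of M) = size M"
  by (simp add: monomial_degree_def size_multiset_overloaded_eq lookup_monomial_of
      set_mset_of[of "monomial_of M", simplified, symmetric])

text \<open>Ties of the weight are broken by a product of distinct primes, which is multiplicative and, by
  unique factorization, injective on monomials.\<close>

definition weight_order :: "'x set \<Rightarrow> ('x \<Rightarrow> nat) \<Rightarrow> ('x \<Rightarrow> nat) \<Rightarrow> 'x monomial rel" where
  "weight_order X w p = {(m, n). m \<in> monomials X \<and> n \<in> monomials X \<and>
     ((\<Sum>x\<in>#mset_of m. w x) < (\<Sum>x\<in>#mset_of n. w x) \<or>
      (\<Sum>x\<in>#mset_of m. w x) = (\<Sum>x\<in>#mset_of n. w x) \<and>
      (\<Prod>x\<in>#mset_of m. p x) \<le> (\<Prod>x\<in>#mset_of n. p x))}"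

lemma monomial_order_weight_order:
  assumes "inj_on p X" "\<And>x. x \<in> X \<Longrightarrow> prime (p x)"
  shows "monomial_order X (weight_order X w p)"
  unfolding monomial_order_def
proof (intro conjI ballI allI impI)
  have "antisym (weight_order X w p)"
  proof (rule antisymI)
    fix m n assume "(m, n) \<in> weight_order X w p" "(n, m) \<in> weight_order X w p"
    then have mn: "set_mset (mset_of m) \<subseteq> X" "set_mset (mset_of n) \<subseteq> X"
      and eq: "(\<Prod>x\<in>#mset_of m. p x) = (\<Prod>x\<in>#mset_of n. p x)"
      by (auto simp: weight_order_def monomials_iff)
    have "prime_factorization (\<Prod>x\<in>#P. p x) = image_mset p P" if "set_mset P \<subseteq> X" for P
      using that assms(2) by (intro prime_factorization_prod_mset_primes) auto
    then have "image_mset p (mset_of m) = image_mset p (mset_of n)"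
      using mn eq by metis
    then show "m = n"
      using image_mset_inj_on[OF assms(1) mn] by (simp add: mset_of_eq_iff)
  qed
  then show "linear_order_on (monomials X) (weight_order X w p)"
    unfolding linear_order_on_def partial_order_on_def preorder_on_def refl_on_def trans_def total_on_def
    by (auto simp: weight_order_def)
next
  fix m assume m: "m \<in> monomials X"
  then have "0 < (\<Prod>x\<in>#mset_of m. p x)"
    using prime_gt_0_nat[OF assms(2)] by (fastforce simp: monomials_iff prod_mset_zero_iff intro!: gr0I)
  then show "(0, m) \<in> weight_order X w p"
    using m monomials_zero by (auto simp: weight_order_def)
next
  fix m n k assume "k \<in> monomials X" "(m, n) \<in> weight_order X w p"
  then show "(m + k, n + k) \<in> weight_order X w p"
    by (auto simp: weight_order_def monomials_add mset_of_add)
qed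

lemma finite_linear_order_greatest:
  assumes "linear_order_on A r" "finite K" "K \<noteq> {}" "K \<subseteq> A"
  obtains m where "m \<in> K" "\<And>n. n \<in> K \<Longrightarrow> (n, m) \<in> r"
proof -
  have "\<exists>m\<in>K. \<forall>n\<in>K. (n, m) \<in> r"
    using assms(2-4)
  proof (induction K rule: finite_ne_induct)
    case (singleton x)
    then show ?case
      using assms(1) by (auto simp: linear_order_on_def partial_order_on_def preorder_on_def refl_on_def)
  next
    case (insert x K)
    then obtain m where m: "m \<in> K" "\<forall>n\<in>K. (n, m) \<in> r" by auto
    have lin: "refl_on A r" "trans r" "total_on A r"
      using assms(1) unfolding linear_order_on_def partial_order_on_def preorder_on_def by simp_all
    have "x \<in> A" "m \<in> A"
      using insert.prems m(1) by auto
    then have refl: "(x, x) \<in> r" and total: "(x, m) \<in> r \<or> (m, x) \<in> r"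
      using lin(1,3) unfolding refl_on_def total_on_def by metis+
    from total show ?case
    proof
      assume "(x, m) \<in> r"
      then show ?case using m by blast
    next
      assume "(m, x) \<in> r"
      then have "(n, x) \<in> r" if "n \<in> K" for n
        using m(2) that lin(2) by (meson transD)
      then show ?case using refl by blast
    qed
  qed
  then show ?thesis using that by blast
qed

lemma initial_monomial_eq:
  assumes "linear_order_on A r" "m \<in> Poly_Mapping.keys p" "\<And>n. n \<in> Poly_Mapping.keys p \<Longrightarrow> (n, m) \<in> r"
  shows "initial_monomial r p = Poly_Mapping.single m 1"
proof -
  have "(THE m. m \<in> Poly_Mapping.keys p \<and> (\<forall>n\<in>Poly_Mapping.keys p. (n, m) \<in> r)) = m"
    using assms by (intro the_equality)
      (auto simp: linear_order_on_def partial_order_on_def antisym_def)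
  then show ?thesis by (simp add: initial_monomial_def)
qed

lemma keys_binomial:
  "m \<noteq> n \<Longrightarrow> Poly_Mapping.keys (Poly_Mapping.single m 1 - Poly_Mapping.single n (1 :: 'k :: field)) = {m, n}"
  by (auto simp: in_keys_iff lookup_minus lookup_single when_def split: if_splits)

lemma genideal_mono: "S \<subseteq> T \<Longrightarrow> genideal R S \<subseteq> genideal R T"
  unfolding genideal_def by blast

text \<open>The hypotheses on \<open>I\<close> are those of a toric ideal, and \<open>I_eq\<close>
  replaces S-pairs and division: the leading monomial of an element shares its fibre with another,
  no heavier monomial of that element, so by confluence it cannot be irreducible. It is therefore
  divisible by the leading monomial of a quadratic move.\<close>

lemma quadratic_groebner_basis:
  fixes I :: "('x, 'k::field) mpoly set"
  assumes "finite X" "quad_confluent X R"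
    and sym: "\<And>M N. R M N \<Longrightarrow> R N M" and trans: "\<And>L M N. R L M \<Longrightarrow> R M N \<Longrightarrow> R L N"
    and add: "\<And>L M N. R M N \<Longrightarrow> R (L + M) (L + N)"
    and refl: "\<And>M. R M M"
    and binomials: "\<And>M N. \<lbrakk>set_mset M \<subseteq> X; set_mset N \<subseteq> X; R M N\<rbrakk> \<Longrightarrow>
      Poly_Mapping.single (monomial_of M) 1 - Poly_Mapping.single (monomial_of N) 1 \<in> I"
    and I_sub: "\<And>f. f \<in> I \<Longrightarrow> Poly_Mapping.keys f \<subseteq> monomials X"
    and I_eq: "\<And>f m. \<lbrakk>f \<in> I; m \<in> Poly_Mapping.keys f\<rbrakk> \<Longrightarrow>
      \<exists>n\<in>Poly_Mapping.keys f. n \<noteq> m \<and> R (mset_of m) (mset_of n)"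
  shows "\<exists>r. monomial_order X r \<and> (\<exists>B. groebner_basis X r I B \<and> (\<forall>g\<in>B. quadratic_binomial g))"
proof -
  obtain w where w: "\<And>M N. \<lbrakk>set_mset M \<subseteq> X; set_mset N \<subseteq> X; R M N; \<not> quad_reducible X R w M;
      \<not> quad_reducible X R w N\<rbrakk> \<Longrightarrow> M = N"
    using assms(2) by (rule quad_confluentE) blast
  obtain h :: "'x \<Rightarrow> nat" where h: "inj_on h X"
    using assms(1) finite_imp_inj_to_nat_seg by metis
  define p where "p x = Infinite_Set.enumerate {p::nat. prime p} (h x)" for x
  have p: "inj_on p X" "\<And>x. x \<in> X \<Longrightarrow> prime (p x)"
    using h primes_infinite enumerate_in_set[OF primes_infinite]
    by (auto simp: p_def inj_on_def) (metis enumerate_mono nat_neq_iff)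
  define r where "r = weight_order X w p"
  have r: "monomial_order X r"
    unfolding r_def using p by (rule monomial_order_weight_order)
  then have lin: "linear_order_on (monomials X) r"
    by (simp add: monomial_order_def)
  define Q where "Q = {(a, b, c, d). {a, b, c, d} \<subseteq> X \<and> R {#a, b#} {#c, d#} \<and> w c + w d < w a + w b}"
  define g :: "'x \<times> 'x \<times> 'x \<times> 'x \<Rightarrow> ('x, 'k) mpoly"
    where "g = (\<lambda>(a, b, c, d). Poly_Mapping.single (monomial_of {#a, b#}) 1
        - Poly_Mapping.single (monomial_of {#c, d#}) 1)"
  have neq: "monomial_of {#a, b#} \<noteq> monomial_of {#c, d#}" if "(a, b, c, d) \<in> Q" for a b c d
  proof
    assume "monomial_of {#a, b#} = monomial_of {#c, d#}"
    then have "{#a, b#} = {#c, d#}" by (simp only: monomial_of_eq_iff)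
    then have "(\<Sum>x\<in>#{#a, b#}. w x) = (\<Sum>x\<in>#{#c, d#}. w x)" by simp
    then show False using that by (simp add: Q_def)
  qed
  have "finite Q"
    using finite_subset[of Q "X \<times> X \<times> X \<times> X"] assms(1) by (auto simp: Q_def)
  then have "finite (g ` Q)" by blast
  moreover have "g ` Q \<subseteq> I"
    using binomials by (auto simp: g_def Q_def)
  moreover have "initial_ideal X r (g ` Q) = initial_ideal X r I"
  proof
    show "initial_ideal X r (g ` Q) \<subseteq> initial_ideal X r I"
      unfolding initial_ideal_def using \<open>g ` Q \<subseteq> I\<close> by (intro genideal_mono) blast
    have "initial_monomial r f \<in> J"
      if f: "f \<in> I" "f \<noteq> 0" and J: "ideal J (mpoly_ring X)" "initial_monomial r ` (g ` Q - {0}) \<subseteq> J" for f J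
    proof -
      have "Poly_Mapping.keys f \<noteq> {}"
        using f(2) by simp
      then obtain m where m: "m \<in> Poly_Mapping.keys f" "\<And>n. n \<in> Poly_Mapping.keys f \<Longrightarrow> (n, m) \<in> r"
        using finite_linear_order_greatest[OF lin finite_keys _ I_sub[OF f(1)]] by blast
      obtain n where n: "n \<in> Poly_Mapping.keys f" "n \<noteq> m" "R (mset_of m) (mset_of n)"
        using I_eq[OF f(1) m(1)] by blast
      define wt where "wt M = (\<Sum>x\<in>#M. w x)" for M
      define M where "M = mset_of m"
      define N where "N = mset_of n"
      have MN: "set_mset M \<subseteq> X" "set_mset N \<subseteq> X" "R M N" "M \<noteq> N" "wt N \<le> wt M"
        using I_sub[OF f(1)] m(1) m(2)[OF n(1)] n by (auto simp: M_def N_def monomials_iff mset_of_eq_iff r_def weight_order_def wt_def)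
      have "quad_reducible X R w M"
      proof -
        \<comment> \<open>\<open>L\<close> is lightest in weight, not least for \<open>r\<close>:
          every monomial of the fibre that is no heavier than \<open>L\<close> is then irreducible.
          If \<open>M\<close> were irreducible it would equal \<open>L\<close>, so \<open>N\<close>
          would be irreducible too, even in a tie, against confluence.\<close>
        obtain L where L: "set_mset L \<subseteq> X" "R M L"
          and least: "\<And>L'. \<lbrakk>set_mset L' \<subseteq> X; R M L'\<rbrakk> \<Longrightarrow> wt L \<le> wt L'"
          using ex_has_least_nat[of "\<lambda>L. set_mset L \<subseteq> X \<and> R M L" M wt] MN(1) refl by blast
        have irred: "\<not> quad_reducible X R w L'" if L': "set_mset L' \<subseteq> X" "R M L'" "wt L' \<le> wt L" for L'
        proof
          assume "quad_reducible X R w L'"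
          then obtain a b c d K where *: "L' = K + {#a, b#}" "c \<in> X" "d \<in> X" "R {#a, b#} {#c, d#}"
              "w c + w d < w a + w b"
            unfolding quad_reducible_def by (metis subset_mset.le_iff_add union_commute)
          then have "R M (K + {#c, d#})"
            using add[OF *(4), of K] trans L'(2) by blast
          moreover have "set_mset (K + {#c, d#}) \<subseteq> X"
            using L'(1) * by auto
          ultimately have "wt L \<le> wt (K + {#c, d#})"
            using least by blast
          then show False
            using L'(3) * by (simp add: wt_def)
        qed
        show ?thesis
        proof (rule ccontr)
          assume nr: "\<not> quad_reducible X R w M"
          then have "M = L"
            using w[OF MN(1) L nr] irred[OF L] by simp
          then have "\<not> quad_reducible X R w N"
            using irred[OF MN(2,3)] MN(5) by simp
          then show False
            using w[OF MN(1-3) nr] MN(4) by blast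
        qed
      qed
      then obtain a b c d K where *: "M = K + {#a, b#}" "c \<in> X" "d \<in> X" "R {#a, b#} {#c, d#}"
          "w c + w d < w a + w b"
        unfolding quad_reducible_def by (metis subset_mset.le_iff_add union_commute)
      then have q: "(a, b, c, d) \<in> Q"
        using MN(1) by (auto simp: Q_def)
      have "(monomial_of {#c, d#}, monomial_of {#a, b#}) \<in> r"
          "(monomial_of {#a, b#}, monomial_of {#a, b#}) \<in> r"
        using * MN(1) by (auto simp: r_def weight_order_def monomial_of_in_monomials)
      then have "initial_monomial r (g (a, b, c, d)) = Poly_Mapping.single (monomial_of {#a, b#}) 1"
        unfolding g_def using keys_binomial[OF neq[OF q], where 'k = 'k]
        by (intro initial_monomial_eq[OF lin]) auto
      moreover have "g (a, b, c, d) \<in> g ` Q - {0}"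
        using q keys_binomial[OF neq[OF q], where 'k = 'k] by (force simp: g_def)
      then have "initial_monomial r (g (a, b, c, d)) \<in> J"
        using J(2) by blast
      ultimately have "Poly_Mapping.single (monomial_of {#a, b#}) 1 \<in> J"
        by simp
      moreover have "Poly_Mapping.single (monomial_of K) 1 \<in> carrier (mpoly_ring X)"
        using MN(1) * by (simp add: mpoly_ring_def monomial_of_in_monomials)
      ultimately have "Poly_Mapping.single (monomial_of K) 1 \<otimes>\<^bsub>mpoly_ring X\<^esub> Poly_Mapping.single (monomial_of {#a, b#}) 1 \<in> J"
        by (rule ideal.I_l_closed[OF J(1)])
      then have "Poly_Mapping.single (monomial_of M) 1 \<in> J"
        by (simp add: mpoly_ring_def mult_single *(1) monomial_of_add del: union_mset_add_mset_right)
      then show ?thesis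
        using initial_monomial_eq[OF lin m] by (simp add: M_def)
    qed
    then show "initial_ideal X r I \<subseteq> initial_ideal X r (g ` Q)"
      unfolding initial_ideal_def genideal_def by blast
  qed
  moreover have "\<forall>f\<in>g ` Q. quadratic_binomial f"
  proof
    fix f assume "f \<in> g ` Q"
    then obtain a b c d where "(a, b, c, d) \<in> Q" "f = Poly_Mapping.single (monomial_of {#a, b#}) 1
        - Poly_Mapping.single (monomial_of {#c, d#}) 1"
      by (auto simp: g_def)
    then show "quadratic_binomial f"
      unfolding quadratic_binomial_def
      by (intro exI[of _ "monomial_of {#a, b#}"] exI[of _ "monomial_of {#c, d#}"])
          (simp add: neq monomial_degree_monomial_of)
  qed
  ultimately show ?thesis
    using r unfolding groebner_basis_def by blast
qed

section \<open>Blocks of the form \<open>K\<^bsub>2,n\<^esub>\<close> and \<open>K\<^bsub>1,1,n\<^esub>\<close>\<close>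

text \<open>Once a root vertex \<open>a\<close> is fixed, a cut is encoded by its side \<open>B\<close> not containing \<open>a\<close>.\<close>

definition cut_equiv :: "'v set set \<Rightarrow> 'v set multiset \<Rightarrow> 'v set multiset \<Rightarrow> bool" where
  "cut_equiv E M N \<longleftrightarrow> size M = size N \<and>
     (\<forall>e\<in>E. size {#B \<in># M. card (B \<inter> e) = 1#} = size {#B \<in># N. card (B \<inter> e) = 1#})"

lemma Inter_in_finite_chain:
  assumes "finite \<C>" "\<C> \<noteq> {}" "\<And>A B. \<lbrakk>A \<in> \<C>; B \<in> \<C>\<rbrakk> \<Longrightarrow> A \<subseteq> B \<or> B \<subseteq> A"
  shows "\<Inter>\<C> \<in> \<C>"
  using assms
proof (induction \<C> rule: finite_ne_induct)
  case (insert A \<C>)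
  then have "\<Inter>\<C> \<in> \<C>" by blast
  then have "A \<subseteq> \<Inter>\<C> \<or> \<Inter>\<C> \<subseteq> A"
    using insert.prems by blast
  then have "A \<inter> \<Inter>\<C> = A \<or> A \<inter> \<Inter>\<C> = \<Inter>\<C>"
    by blast
  then show ?case
    using \<open>\<Inter>\<C> \<in> \<C>\<close> by auto
qed simp

lemma Union_in_finite_chain:
  assumes "finite \<C>" "\<C> \<noteq> {}" "\<And>A B. \<lbrakk>A \<in> \<C>; B \<in> \<C>\<rbrakk> \<Longrightarrow> A \<subseteq> B \<or> B \<subseteq> A"
  shows "\<Union>\<C> \<in> \<C>"
  using assms
proof (induction \<C> rule: finite_ne_induct)
  case (insert A \<C>)
  then have "\<Union>\<C> \<in> \<C>" by blast
  then have "A \<subseteq> \<Union>\<C> \<or> \<Union>\<C> \<subseteq> A"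
    using insert.prems by blast
  then have "A \<union> \<Union>\<C> = A \<or> A \<union> \<Union>\<C> = \<Union>\<C>"
    by blast
  then show ?case
    using \<open>\<Union>\<C> \<in> \<C>\<close> by auto
qed simp

lemma size_filter_mset_eq_size_iff:
  "size (filter_mset P M) = size M \<longleftrightarrow> (\<forall>x\<in>#M. P x)"
proof
  assume "size (filter_mset P M) = size M"
  then have "filter_mset P M = M"
    by (metis mset_subset_size multiset_filter_subset nat_less_le subset_mset.le_neq_trans)
  then show "\<forall>x\<in>#M. P x"
    by (metis filter_mset_eq_conv)
next
  assume "\<forall>x\<in>#M. P x"
  then have "filter_mset P M = M"
    by (simp add: filter_mset_eq_conv)
  then show "size (filter_mset P M) = size M" by simp
qed

text \<open>The smallest member of a chain is its intersection, which consists of the elements whose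
  count equals the size of the multiset. It can thus be read off from the counts and peeled
  off.\<close>

lemma chain_mset_eq:
  assumes "\<And>A B. \<lbrakk>A \<in># M; B \<in># M\<rbrakk> \<Longrightarrow> A \<subseteq> B \<or> B \<subseteq> A"
    and "\<And>A B. \<lbrakk>A \<in># N; B \<in># N\<rbrakk> \<Longrightarrow> A \<subseteq> B \<or> B \<subseteq> A"
    and "size M = size N" "\<And>c. size {#B \<in># M. c \<in> B#} = size {#B \<in># N. c \<in> B#}"
  shows "M = N"
  using assms
proof (induction "size M" arbitrary: M N)
  case 0
  then show ?case by auto
next
  case (Suc n)
  have I: "\<Inter>(set_mset P) = {c. size {#B \<in># P. c \<in> B#} = size P}" for P :: "'a set multiset"
    by (auto simp: size_filter_mset_eq_size_iff)
  have "\<Inter>(set_mset M) \<in># M"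
    using Suc.hyps(2) Suc.prems(1) by (intro Inter_in_finite_chain) auto
  moreover have "\<Inter>(set_mset N) \<in># N"
    using Suc.hyps(2) Suc.prems(2,3) by (intro Inter_in_finite_chain) auto
  moreover have "\<Inter>(set_mset M) = \<Inter>(set_mset N)"
    unfolding I using Suc.prems(3,4) by simp
  ultimately obtain A M' N' where MN: "M = add_mset A M'" "N = add_mset A N'"
    by (metis insert_DiffM)
  have "size {#B \<in># M'. c \<in> B#} = size {#B \<in># N'. c \<in> B#}" for c
    using Suc.prems(4)[of c] by (simp add: MN split: if_splits)
  moreover have "A1 \<subseteq> B1 \<or> B1 \<subseteq> A1" if "A1 \<in># M'" "B1 \<in># M'" for A1 B1
    using Suc.prems(1)[of A1 B1] that by (simp add: MN)
  moreover have "A1 \<subseteq> B1 \<or> B1 \<subseteq> A1" if "A1 \<in># N'" "B1 \<in># N'" for A1 B1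
    using Suc.prems(2)[of A1 B1] that by (simp add: MN)
  ultimately have "M' = N'"
    using Suc.prems(3) Suc.hyps(2) by (intro Suc.hyps(1)) (auto simp: MN)
  then show ?case by (simp add: MN)
qed

lemma card_Int_pair: "x \<noteq> y \<Longrightarrow> card (B \<inter> {x, y}) = 1 \<longleftrightarrow> (x \<in> B) \<noteq> (y \<in> B)"
  by (cases "x \<in> B"; cases "y \<in> B") auto

lemma size_filter_mset_split:
  "size (filter_mset P M) = size (filter_mset (\<lambda>x. P x \<and> Q x) M) + size (filter_mset (\<lambda>x. P x \<and> \<not> Q x) M)"
  by (induction M) auto

text \<open>\<open>a\<close> is the root, \<open>b\<close> the second pole and \<open>C\<close> the
  set of pages. Leaving \<open>{a, b}\<close> open treats both families, and with empty
  \<open>C\<close> the single edge, at once. \<open>nontriv\<close> rules out two isolated vertices,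
  where \<open>{}\<close> and \<open>{b}\<close> would have the same image.\<close>

context
  fixes a b :: 'v and C :: "'v set" and E :: "'v set set"
  assumes ab: "a \<noteq> b" "a \<notin> C" "b \<notin> C" and finC: "finite C"
    and E: "E - {{a, b}} = (\<lambda>c. {a, c}) ` C \<union> (\<lambda>c. {b, c}) ` C"
    and nontriv: "{a, b} \<in> E \<or> C \<noteq> {}"
begin

text \<open>No set in \<open>Pow (insert b C)\<close> contains the root \<open>a\<close>, so an edge
  at \<open>a\<close> is cut exactly when its other end lies in the set.\<close>

lemma cut_equiv_block_iff:
  assumes "set_mset M \<subseteq> Pow (insert b C)" "set_mset N \<subseteq> Pow (insert b C)"
  shows "cut_equiv E M N \<longleftrightarrow> size M = size N \<and>
    (\<forall>c\<in>C. size {#B \<in># M. c \<in> B#} = size {#B \<in># N. c \<in> B#} \<and>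
       size {#B \<in># M. (b \<in> B) \<noteq> (c \<in> B)#} = size {#B \<in># N. (b \<in> B) \<noteq> (c \<in> B)#}) \<and>
    ({a, b} \<in> E \<longrightarrow> size {#B \<in># M. b \<in> B#} = size {#B \<in># N. b \<in> B#})"
proof -
  have 1: "{#B \<in># P. card (B \<inter> {a, c}) = 1#} = {#B \<in># P. c \<in> B#}"
    if "set_mset P \<subseteq> Pow (insert b C)" "c \<in> insert b C" for P c
    using that ab by (intro filter_mset_cong refl, subst card_Int_pair) auto
  have 2: "{#B \<in># P. card (B \<inter> {b, c}) = 1#} = {#B \<in># P. (b \<in> B) \<noteq> (c \<in> B)#}"
    if "c \<in> C" for P c
    using that ab by (intro filter_mset_cong refl, subst card_Int_pair) auto
  have "(\<forall>e\<in>E. Q e) \<longleftrightarrow> (\<forall>e\<in>E - {{a, b}}. Q e) \<and> ({a, b} \<in> E \<longrightarrow> Q {a, b})" for Q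
    by blast
  then have "(\<forall>e\<in>E. Q e) \<longleftrightarrow> (\<forall>c\<in>C. Q {a, c} \<and> Q {b, c}) \<and> ({a, b} \<in> E \<longrightarrow> Q {a, b})" for Q
    unfolding E by (simp add: ball_Un ball_conj_distrib)
  then show ?thesis
    unfolding cut_equiv_def using assms by (simp add: 1 2 del: One_nat_def)
qed

text \<open>The quadratic term is strictly concave in \<open>|B \<inter> C|\<close>, so uncrossing two sets on which \<open>b\<close> lies on
  the same side lowers the weight. Without the edge \<open>ab\<close> there is one more relation,
  \<open>{b}, insert b C \<rightarrow> {}, C\<close>, which keeps the quadratic terms; the last summand orients it.\<close>

definition block_weight :: "'v set \<Rightarrow> nat" where
  "block_weight B = card C * card C - card (B \<inter> C) * card (B \<inter> C) + (if b \<in> B then 1 else 0)"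

lemma block_weight_Int_Un:
  assumes "B \<subseteq> insert b C" "B' \<subseteq> insert b C" "b \<in> B \<longleftrightarrow> b \<in> B'" "\<not> B \<subseteq> B'" "\<not> B' \<subseteq> B"
  shows "block_weight (B \<inter> B') + block_weight (B \<union> B') < block_weight B + block_weight B'"
proof -
  define k i j where "k = card (B \<inter> B' \<inter> C)" and "i = card (B \<inter> C - B')" and "j = card (B' \<inter> C - B)"
  have fin: "finite (X \<inter> C)" for X
    using finC by auto
  have B: "card (B \<inter> C) = k + i"
    using card_Int_Diff[OF fin[of B], of B'] by (simp add: k_def i_def Int_ac)
  have B': "card (B' \<inter> C) = k + j"
    using card_Int_Diff[OF fin[of B'], of B] by (simp add: k_def j_def Int_ac)
  have "(B \<union> B') \<inter> C = (B \<inter> C) \<union> (B' \<inter> C - B)"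
    by blast
  then have U: "card ((B \<union> B') \<inter> C) = k + i + j"
    using B fin card_Un_disjoint[of "B \<inter> C" "B' \<inter> C - B"] by (auto simp: j_def)
  \<comment> \<open>\<open>B\<close> and \<open>B'\<close> agree at \<open>b\<close>, so their
    incomparability shows inside \<open>C\<close>. The gap in the next inequality is
    \<open>2 * i * j\<close>.\<close>
  have "i > 0" "j > 0"
    using assms fin by (auto simp: i_def j_def card_gt_0_iff)
  then have "(k + i) * (k + i) + (k + j) * (k + j) < k * k + (k + i + j) * (k + i + j)"
    by (simp add: algebra_simps)
  \<comment> \<open>This bound makes the truncated subtractions in \<open>block_weight\<close>
    exact.\<close>
  moreover have "card (X \<inter> C) * card (X \<inter> C) \<le> card C * card C" for X
    using finC by (intro mult_le_mono card_mono) auto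
  note this[of B] this[of B'] this[of "B \<inter> B'"] this[of "B \<union> B'"]
  ultimately show ?thesis
    using assms(3) B B' U by (simp add: block_weight_def k_def)
qed

lemma irreducible_block:
  assumes M: "set_mset M \<subseteq> Pow (insert b C)"
    and nr: "\<not> quad_reducible (Pow (insert b C)) (cut_equiv E) block_weight M"
  shows "\<And>B B'. \<lbrakk>B \<in># M; B' \<in># M; b \<in> B \<longleftrightarrow> b \<in> B'\<rbrakk> \<Longrightarrow> B \<subseteq> B' \<or> B' \<subseteq> B"
    and "{a, b} \<notin> E \<Longrightarrow> {b} \<notin># M \<or> insert b C \<notin># M"
proof -
  fix B B' assume B: "B \<in># M" "B' \<in># M" "b \<in> B \<longleftrightarrow> b \<in> B'"
  show "B \<subseteq> B' \<or> B' \<subseteq> B"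
  proof (rule ccontr)
    assume "\<not> (B \<subseteq> B' \<or> B' \<subseteq> B)"
    moreover have "B \<subseteq> insert b C" "B' \<subseteq> insert b C"
      using B M by auto
    moreover have "{#B, B'#} \<subseteq># M"
      using B calculation(1) by (intro pair_subseteq_mset) auto
    moreover have "cut_equiv E {#B, B'#} {#B \<inter> B', B \<union> B'#}"
      using calculation B by (subst cut_equiv_block_iff) auto
    ultimately have "quad_reducible (Pow (insert b C)) (cut_equiv E) block_weight M"
      using B by (intro quad_reducibleI[of B B' M "B \<inter> B'" _ "B \<union> B'"] block_weight_Int_Un) auto
    then show False using nr by blast
  qed
next
  assume "{a, b} \<notin> E"
  show "{b} \<notin># M \<or> insert b C \<notin># M"
  proof (rule ccontr)
    assume "\<not> ({b} \<notin># M \<or> insert b C \<notin># M)"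
    then have "{#{b}, insert b C#} \<subseteq># M"
      using ab \<open>{a, b} \<notin> E\<close> nontriv by (intro pair_subseteq_mset) auto
    \<comment> \<open>Each edge from a pole to a page is cut once on either side, but
      \<open>ab\<close> would be cut twice on the left and never on the right: the relation needs
      \<open>ab\<close> to be missing.\<close>
    moreover have "cut_equiv E {#{b}, insert b C#} {#{}, C#}"
      using ab \<open>{a, b} \<notin> E\<close> by (subst cut_equiv_block_iff) auto
    ultimately have "quad_reducible (Pow (insert b C)) (cut_equiv E) block_weight M"
      using ab by (intro quad_reducibleI[of "{b}" "insert b C" M "{}" _ C]) (auto simp: block_weight_def)
    then show False using nr by blast
  qed
qed

text \<open>The number of cuts separating \<open>a\<close> from \<open>b\<close> is not visible in the image when \<open>ab\<close> is no edge. It is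
  recovered as the largest absolute difference, over \<open>c \<in> C\<close>, of the numbers of cuts through \<open>ac\<close> and through
  \<open>bc\<close>: the next lemma provides a \<open>c\<close> attaining it.\<close>

lemma irreducible_block_extreme:
  assumes M: "set_mset M \<subseteq> Pow (insert b C)"
    and nr: "\<not> quad_reducible (Pow (insert b C)) (cut_equiv E) block_weight M"
    and "{a, b} \<notin> E" "{#B \<in># M. b \<in> B#} \<noteq> {#}"
  obtains c where "c \<in> C" "{#B \<in># M. b \<in> B \<and> c \<in> B#} = {#} \<or> {#B \<in># M. b \<in> B \<and> c \<notin> B#} = {#}"
proof -
  define \<C> where "\<C> = set_mset {#B \<in># M. b \<in> B#}"
  have chain: "A \<subseteq> B \<or> B \<subseteq> A" if "A \<in> \<C>" "B \<in> \<C>" for A B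
    using irreducible_block(1)[OF M nr] that by (auto simp: \<C>_def)
  have "finite \<C>" "\<C> \<noteq> {}"
    using assms(4) by (auto simp: \<C>_def simp del: set_mset_filter)
  then have "\<Inter>\<C> \<in> \<C>" "\<Union>\<C> \<in> \<C>"
    using chain Inter_in_finite_chain Union_in_finite_chain by blast+
  then have mem: "\<Inter>\<C> \<in># M" "b \<in> \<Inter>\<C>" "\<Union>\<C> \<in># M" "b \<in> \<Union>\<C>"
    by (auto simp: \<C>_def)
  \<comment> \<open>Otherwise the extra relation would apply to the least and the largest separating
    set. A page in the least one lies in all of them, a page outside the largest one in
    none.\<close>
  have "\<Inter>\<C> \<noteq> {b} \<or> \<Union>\<C> \<noteq> insert b C"
    using irreducible_block(2)[OF M nr assms(3)] mem by metis
  then show ?thesis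
  proof
    assume "\<Inter>\<C> \<noteq> {b}"
    then obtain c where c: "c \<in> \<Inter>\<C>" "c \<in> C"
      using mem M by blast
    then have "{#B \<in># M. b \<in> B \<and> c \<notin> B#} = {#}"
      by (auto simp: \<C>_def)
    then show ?thesis using c that by blast
  next
    assume "\<Union>\<C> \<noteq> insert b C"
    then obtain c where c: "c \<notin> \<Union>\<C>" "c \<in> C"
      using mem M by blast
    then have "{#B \<in># M. b \<in> B \<and> c \<in> B#} = {#}"
      by (auto simp: \<C>_def)
    then show ?thesis using c that by blast
  qed
qed

text \<open>A fibre fixes \<alpha> + \<gamma> and \<beta> + \<gamma> at every page. Once
  \<open>k\<close>, which is \<alpha> + \<beta>, is known as well, all three counts follow, and with
  them the two chains of sets with and without \<open>b\<close>.\<close>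

lemma quad_confluent_block: "quad_confluent (Pow (insert b C)) (cut_equiv E)"
proof (rule quad_confluentI[of _ _ block_weight])
  fix M N
  assume M: "set_mset M \<subseteq> Pow (insert b C)" "\<not> quad_reducible (Pow (insert b C))
      (cut_equiv E) block_weight M"
    and N: "set_mset N \<subseteq> Pow (insert b C)" "\<not> quad_reducible (Pow (insert b C))
        (cut_equiv E) block_weight N"
    and MN: "cut_equiv E M N"
  define k \<alpha> \<beta> \<gamma> where "k P = size {#B \<in># P. b \<in> B#}"
    and "\<alpha> P c = size {#B \<in># P. b \<in> B \<and> c \<in> B#}"
    and "\<beta> P c = size {#B \<in># P. b \<in> B \<and> c \<notin> B#}"
    and "\<gamma> P c = size {#B \<in># P. b \<notin> B \<and> c \<in> B#}" for P c
  have k: "k P = \<alpha> P c + \<beta> P c" for P c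
    unfolding k_def \<alpha>_def \<beta>_def by (rule size_filter_mset_split)
  have sizes: "size M = size N" and
    eqs: "\<And>c. c \<in> C \<Longrightarrow> \<alpha> M c + \<gamma> M c = \<alpha> N c + \<gamma> N c \<and> \<beta> M c + \<gamma> M c = \<beta> N c + \<gamma> N c"
    and kE: "{a, b} \<in> E \<Longrightarrow> k M = k N"
  proof -
    have "size {#B \<in># P. c \<in> B#} = \<alpha> P c + \<gamma> P c"
      "size {#B \<in># P. (b \<in> B) \<noteq> (c \<in> B)#} = \<beta> P c + \<gamma> P c" for P c
      unfolding \<alpha>_def \<beta>_def \<gamma>_def by (induction P) auto
    then show "size M = size N"
      "\<And>c. c \<in> C \<Longrightarrow> \<alpha> M c + \<gamma> M c = \<alpha> N c + \<gamma> N c \<and> \<beta> M c + \<gamma> M c = \<beta> N c + \<gamma> N c"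
      "{a, b} \<in> E \<Longrightarrow> k M = k N"
      using MN[unfolded cut_equiv_block_iff[OF M(1) N(1)]] by (auto simp: k_def)
  qed
  have kMN: "k M = k N"
  proof (cases "{a, b} \<in> E")
    case False
    \<comment> \<open>The difference \<alpha> - \<beta> at a page is constant on the fibre. At the
      extreme page of \<open>P\<close> its absolute value is \<open>k P\<close>, and for
      \<open>Q\<close> it is at most \<open>k Q\<close>.\<close>
    have "k P \<le> k Q"
      if P: "set_mset P \<subseteq> Pow (insert b C)" "\<not> quad_reducible (Pow (insert b C))
          (cut_equiv E) block_weight P"
        and eqs: "\<And>c. c \<in> C \<Longrightarrow> \<alpha> P c + \<gamma> P c = \<alpha> Q c + \<gamma> Q c \<and> \<beta> P c + \<gamma> P c = \<beta> Q c + \<gamma> Q c" for P Q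
    proof (cases "{#B \<in># P. b \<in> B#} = {#}")
      case nonempty: False
      obtain c where "c \<in> C" "{#B \<in># P. b \<in> B \<and> c \<in> B#} = {#} \<or> {#B \<in># P. b \<in> B \<and> c \<notin> B#} = {#}"
        using irreducible_block_extreme[OF P False nonempty] .
      then have "\<alpha> P c = 0 \<or> \<beta> P c = 0"
        by (auto simp: \<alpha>_def \<beta>_def)
      then show ?thesis
        using eqs[OF \<open>c \<in> C\<close>] k[of P c] k[of Q c] by linarith
    next
      case True
      then show ?thesis
        unfolding k_def by (simp only: size_empty)
    qed
    from this[OF M, of N] this[OF N, of M] eqs show ?thesis
      by (metis le_antisym)
  qed (rule kE)
  have abc: "\<alpha> M c = \<alpha> N c" "\<gamma> M c = \<gamma> N c" if "c \<in> C" for c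
    using eqs[OF that] k[of M c] k[of N c] kMN by linarith+
  have "{#B \<in># M. b \<in> B#} = {#B \<in># N. b \<in> B#}"
  proof (rule chain_mset_eq)
    fix c
    consider "c \<in> C" | "c = b" | "c \<notin> insert b C" by blast
    then show "size {#B \<in># {#B \<in># M. b \<in> B#}. c \<in> B#} = size {#B \<in># {#B \<in># N. b \<in> B#}. c \<in> B#}"
    proof cases
      case 1
      then show ?thesis
        using abc by (simp add: filter_filter_mset \<alpha>_def)
    next
      case 2
      then show ?thesis
        using kMN by (simp add: filter_filter_mset k_def)
    next
      case 3
      then have "{#B \<in># {#B \<in># P. b \<in> B#}. c \<in> B#} = {#}" if "set_mset P \<subseteq> Pow (insert b C)" for P
        using that by auto
      from this[OF M(1)] this[OF N(1)] show ?thesis by (simp only:)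
    qed
  qed (use irreducible_block(1)[OF M] irreducible_block(1)[OF N] kMN in \<open>auto simp: k_def\<close>)
  moreover have "{#B \<in># M. b \<notin> B#} = {#B \<in># N. b \<notin> B#}"
  proof (rule chain_mset_eq)
    fix c
    consider "c \<in> C" | "c \<notin> C" by blast
    then show "size {#B \<in># {#B \<in># M. b \<notin> B#}. c \<in> B#} = size {#B \<in># {#B \<in># N. b \<notin> B#}. c \<in> B#}"
    proof cases
      case 1
      then show ?thesis
        using abc by (simp add: filter_filter_mset \<gamma>_def)
    next
      case 2
      then have "{#B \<in># {#B \<in># P. b \<notin> B#}. c \<in> B#} = {#}" if "set_mset P \<subseteq> Pow (insert b C)" for P
        using that by auto
      from this[OF M(1)] this[OF N(1)] show ?thesis by (simp only:)
    qed
  next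
    show "size {#B \<in># M. b \<notin> B#} = size {#B \<in># N. b \<notin> B#}"
      using size_filter_mset_split[of "\<lambda>_. True" M "\<lambda>B. b \<in> B"]
        size_filter_mset_split[of "\<lambda>_. True" N "\<lambda>B. b \<in> B"] sizes kMN
      by (simp add: k_def)
  qed (use irreducible_block(1)[OF M] irreducible_block(1)[OF N] in auto)
  ultimately show "M = N"
    by (metis multiset_partition)
qed

end

section \<open>Graphs without long cycles\<close>

text \<open>Two adjacent vertices also form such a list. This degenerate case is harmless, because
  only lists of length at least five are ever excluded.\<close>

definition cycle_list :: "'v set set \<Rightarrow> 'v list \<Rightarrow> bool" where
  "cycle_list E xs \<longleftrightarrow> distinct xs \<and> successively (\<lambda>x y. {x, y} \<in> E) xs \<and> {last xs, hd xs} \<in> E"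

lemma simple_graph_edgeD:
  assumes "simple_graph G" "{x, y} \<in> edges G"
  shows "x \<in> verts G" "y \<in> verts G" "x \<noteq> y"
  using assms unfolding simple_graph_def by fastforce+

text \<open>For maps that may collapse an edge to a point: contraction of an edge, and retraction of
  a graph onto one side of a separation.\<close>

lemma rtrancl_map_rtrancl:
  assumes "(x, y) \<in> r\<^sup>*" "\<And>a b. (a, b) \<in> r \<Longrightarrow> (f a, f b) \<in> s\<^sup>*"
  shows "(f x, f y) \<in> s\<^sup>*"
  using assms(1) by (induction rule: rtrancl_induct) (auto intro: assms(2) rtrancl_trans)

lemma boundary_edge:
  assumes "connected_graph G" "simple_graph G" "S \<subseteq> verts G" "S \<noteq> {}" "S \<noteq> verts G"
  obtains u v where "u \<in> S" "v \<in> verts G - S" "{u, v} \<in> edges G"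
proof -
  obtain x y where xy: "x \<in> S" "y \<in> verts G - S"
    using assms by blast
  then have "(x, y) \<in> {(x, y). {x, y} \<in> edges G}\<^sup>*"
    using assms unfolding connected_graph_def by blast
  then have "y \<in> S \<or> (\<exists>u\<in>S. \<exists>v\<in>verts G - S. {u, v} \<in> edges G)"
  proof (induction rule: rtrancl_induct)
    case (step y z)
    then show ?case
      using simple_graph_edgeD[OF assms(2), of y z] by auto
  qed (use xy in simp)
  then show ?thesis using xy that by blast
qed

lemma simple_graph_contract_edge: "simple_graph G \<Longrightarrow> {u, v} \<in> edges G \<Longrightarrow> simple_graph (contract_edge u v G)"
  using simple_graph_edgeD[of G u v]
  unfolding simple_graph_def contract_edge_def by (fastforce simp: image_subset_iff)

lemma contract_edgeI:
  assumes "e \<in> edges G" "card (id(v := u) ` e) = 2"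
  shows "id(v := u) ` e \<in> edges (contract_edge u v G)"
  using assms by (auto simp: contract_edge_def)

lemma contract_edge_edgeI:
  assumes "{x, y} \<in> edges G" "x \<noteq> y" "x \<noteq> v" "y \<noteq> v"
  shows "{x, y} \<in> edges (contract_edge u v G)"
  using contract_edgeI[OF assms(1), of v u] assms by simp

lemma connected_graph_contract_edge:
  assumes "connected_graph G" "simple_graph G" "{u, v} \<in> edges G"
  shows "connected_graph (contract_edge u v G)"
proof -
  let ?G = "contract_edge u v G"
  have uv: "u \<in> verts G" "v \<in> verts G" "u \<noteq> v"
    using simple_graph_edgeD[OF assms(2,3)] by auto
  have step: "((id(v := u)) a, (id(v := u)) b) \<in> {(x, y). {x, y} \<in> edges ?G}\<^sup>*"
    if "{a, b} \<in> edges G" for a b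
  proof (cases "(id(v := u)) a = (id(v := u)) b")
    case False
    then have "card (id(v := u) ` {a, b}) = 2"
      by (simp only: image_insert image_empty card_2_iff) blast
    then have "{(id(v := u)) a, (id(v := u)) b} \<in> edges ?G"
      using contract_edgeI[OF that, of v u] by (simp only: image_insert image_empty)
    then show ?thesis by blast
  qed simp
  have "(x, y) \<in> {(x, y). {x, y} \<in> edges ?G}\<^sup>*" if "x \<in> verts ?G" "y \<in> verts ?G" for x y
  proof -
    have "x \<in> verts G" "y \<in> verts G" "x \<noteq> v" "y \<noteq> v"
      using that by (auto simp: contract_edge_def)
    then have "(x, y) \<in> {(x, y). {x, y} \<in> edges G}\<^sup>*"
      using assms(1) unfolding connected_graph_def by blast
    from rtrancl_map_rtrancl[OF this, of "id(v := u)"] step \<open>x \<noteq> v\<close> \<open>y \<noteq> v\<close> show ?thesis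
      by fastforce
  qed
  moreover have "verts ?G \<noteq> {}"
    using uv by (auto simp: contract_edge_def)
  ultimately show ?thesis unfolding connected_graph_def by blast
qed

section \<open>Long cycles and cliques yield minors\<close>

lemma is_minor_step: "minor_step G G' \<Longrightarrow> is_minor H G' \<Longrightarrow> is_minor H G"
  unfolding is_minor_def by (meson converse_rtranclp_into_rtranclp)

lemma delete_edges_minor_steps:
  assumes "finite D" "D \<subseteq> edges G"
  shows "minor_step\<^sup>*\<^sup>* G (G\<lparr>edges := edges G - D\<rparr>)"
  using assms
proof (induction D rule: finite_induct)
  case (insert e D)
  let ?G = "G\<lparr>edges := edges G - D\<rparr>"
  have "minor_step ?G (delete_edge e ?G)"
    using insert by (intro minor_step.delete) auto
  moreover have "delete_edge e ?G = G\<lparr>edges := edges G - insert e D\<rparr>"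
    by (simp add: delete_edge_def Diff_insert[symmetric])
  ultimately show ?case
    using insert by (simp add: rtranclp.rtrancl_into_rtrancl)
qed simp

lemma simple_graph_finite_edges: "simple_graph G \<Longrightarrow> finite (edges G)"
  unfolding simple_graph_def by (metis Pow_iff finite_Pow_iff finite_subset subsetI)

text \<open>Minor steps cannot delete a vertex, so by connectedness a spare vertex is contracted
  into the image of \<open>f\<close> along a boundary edge. Edges of the image avoid that vertex and
  survive; surplus edges are deleted at the end.\<close>

lemma is_minor_embedding:
  assumes "simple_graph G" "connected_graph G" "simple_graph H" "verts H \<noteq> {}"
    and "inj_on f (verts H)" "f ` verts H \<subseteq> verts G" "\<And>e. e \<in> edges H \<Longrightarrow> f ` e \<in> edges G"
  shows "is_minor H G"
  using assms
proof (induction "card (verts G)" arbitrary: G rule: less_induct)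
  case less
  have fin: "finite (verts G)"
    using less.prems(1) by (simp add: simple_graph_def)
  show ?case
  proof (cases "f ` verts H = verts G")
    case True
    define G' where "G' = G\<lparr>edges := edges G - (edges G - (`) f ` edges H)\<rparr>"
    have "minor_step\<^sup>*\<^sup>* G G'"
      unfolding G'_def
      using simple_graph_finite_edges[OF less.prems(1)] by (intro delete_edges_minor_steps) auto
    moreover have "graph_iso G' H"
    proof -
      let ?g = "inv_into (verts H) f"
      have "verts G' = verts G" "edges G' = (`) f ` edges H"
        using less.prems(7) by (auto simp: G'_def)
      moreover have "?g ` f ` e = e" if "e \<in> edges H" for e
        using that less.prems(3,5) by (intro inv_into_image_cancel) (auto simp: simple_graph_def)
      then have "(`) ?g ` (`) f ` edges H = edges H"
        by (simp add: image_image)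
      moreover have "bij_betw ?g (verts G) (verts H)"
        using less.prems(5) True by (metis bij_betw_inv_into bij_betw_imageI)
      ultimately show ?thesis
        unfolding graph_iso_def by metis
    qed
    ultimately show ?thesis
      unfolding is_minor_def by blast
  next
    case False
    obtain u v where uv: "u \<in> f ` verts H" "v \<in> verts G - f ` verts H" "{u, v} \<in> edges G"
      using boundary_edge[OF less.prems(2,1,6)] less.prems(4) False by blast
    let ?G = "contract_edge u v G"
    have "is_minor H ?G"
    proof (rule less.hyps)
      show "card (verts ?G) < card (verts G)"
        using uv fin card_Diff1_less[of "verts G" v] by (simp add: contract_edge_def)
      show "simple_graph ?G" "connected_graph ?G"
        using simple_graph_contract_edge[OF less.prems(1) uv(3)]
          connected_graph_contract_edge[OF less.prems(2,1) uv(3)] by auto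
      show "f ` verts H \<subseteq> verts ?G"
        using less.prems(6) uv by (auto simp: contract_edge_def)
      fix e assume e: "e \<in> edges H"
      then have "v \<notin> f ` e"
        using uv(2) less.prems(3) by (auto simp: simple_graph_def)
      then have "id(v := u) ` f ` e = f ` e"
        by (auto simp: image_image image_iff)
      moreover have "card (f ` e) = 2"
        using less.prems(1,7) e unfolding simple_graph_def by blast
      ultimately show "f ` e \<in> edges ?G"
        using contract_edgeI[OF less.prems(7)[OF e], of v u] by simp
    qed (fact less.prems)+
    then show ?thesis
      using is_minor_step[OF minor_step.contract[OF uv(3)]] by blast
  qed
qed

lemma simple_graph_complete_graph: "simple_graph (complete_graph n)"
  by (simp add: simple_graph_def complete_graph_def)

lemma simple_graph_cycle_graph: "n \<ge> 2 \<Longrightarrow> simple_graph (cycle_graph n)"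
proof -
  assume n: "n \<ge> 2"
  have "i \<noteq> (i + 1) mod n" if "i < n" for i
    using n that by (cases "i + 1 = n") auto
  then show ?thesis
    using n by (auto simp: simple_graph_def cycle_graph_def)
qed

text \<open>While the cycle is too long, contracting its first edge shortens it by one; only the
  closing edge is renamed. At length \<open>n\<close> it is an embedded copy of the target.\<close>

lemma cycle_minor:
  assumes "simple_graph G" "connected_graph G" "cycle_list (edges G) xs" "length xs \<ge> n" "n \<ge> 3"
  shows "is_minor (cycle_graph n) G"
  using assms
proof (induction xs arbitrary: G rule: length_induct)
  case (1 xs)
  note less = "1.prems"
  show ?case
  proof (cases "length xs = n")
    case True
    have "xs \<noteq> []"
      using True less(5) by auto
    then have "last xs = xs ! (n - 1)" "hd xs = xs ! 0"
      using True by (simp_all add: last_conv_nth hd_conv_nth)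
    then have dist: "distinct xs" and adj: "\<And>i. Suc i < n \<Longrightarrow> {xs ! i, xs ! Suc i} \<in> edges G"
      and lst: "{xs ! (n - 1), xs ! 0} \<in> edges G"
      using less(3) True unfolding cycle_list_def successively_conv_nth by simp_all
    have ed: "{xs ! i, xs ! ((i + 1) mod n)} \<in> edges G" if "i < n" for i
      using that adj[of i] lst by (cases "Suc i = n") auto
    show ?thesis
    proof (rule is_minor_embedding[where f = "(!) xs"])
      show "inj_on ((!) xs) (verts (cycle_graph n))"
        using dist True by (auto simp: cycle_graph_def inj_on_def nth_eq_iff_index_eq)
      show "(!) xs ` verts (cycle_graph n) \<subseteq> verts G"
        unfolding cycle_graph_def using simple_graph_edgeD(1)[OF less(1) ed] by fastforce
      show "verts (cycle_graph n) \<noteq> {}"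
        using \<open>n \<ge> 3\<close> by (simp add: cycle_graph_def lessThan_empty_iff)
      fix e assume "e \<in> edges (cycle_graph n)"
      then show "(!) xs ` e \<in> edges G"
        using ed by (auto simp: cycle_graph_def)
    qed (use less(1,2,5) simple_graph_cycle_graph[of n] in auto)
  next
    case False
    have "Suc (Suc (Suc 0)) \<le> length xs"
      using less(4,5) by simp
    then obtain v u y zs where xs: "xs = v # u # y # zs"
      by (auto simp: Suc_le_length_iff)
    let ?G = "contract_edge u v G"
    have uv: "{u, v} \<in> edges G" and "distinct (v # u # y # zs)"
      using less(3) by (auto simp: xs cycle_list_def insert_commute)
    have "successively (\<lambda>x y. {x, y} \<in> edges ?G) (u # y # zs)"
    proof (rule successively_mono)
      show "successively (\<lambda>x z. {x, z} \<in> edges G \<and> x \<noteq> v \<and> z \<noteq> v) (u # y # zs)"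
      proof (rule successively_cong[THEN iffD1, rotated 2])
        show "successively (\<lambda>x y. {x, y} \<in> edges G) (u # y # zs)"
          using less(3) by (simp add: xs cycle_list_def)
        show "{a, b} \<in> edges G \<longleftrightarrow> {a, b} \<in> edges G \<and> a \<noteq> v \<and> b \<noteq> v"
          if "a \<in> set (u # y # zs)" "b \<in> set (u # y # zs)" for a b
          using that \<open>distinct (v # u # y # zs)\<close> by auto
      qed simp
    qed (auto intro!: contract_edge_edgeI dest: simple_graph_edgeD[OF less(1)])
    moreover have "{last (y # zs), u} \<in> edges ?G"
    proof -
      have "{last (y # zs), v} \<in> edges G"
        using less(3) by (simp add: xs cycle_list_def split: if_splits)
      moreover have "last (y # zs) \<noteq> v" "last (y # zs) \<noteq> u"
        using \<open>distinct (v # u # y # zs)\<close> last_in_set[of "y # zs"] by auto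
      ultimately show ?thesis
        using contract_edgeI[of "{last (y # zs), v}" G v u] by simp
    qed
    ultimately have "cycle_list (edges ?G) (u # y # zs)"
      using \<open>distinct (v # u # y # zs)\<close> by (simp add: cycle_list_def)
    then have "is_minor (cycle_graph n) ?G"
      using "1.IH"[rule_format, of "u # y # zs" ?G] less(4,5) False simple_graph_contract_edge[OF less(1) uv]
        connected_graph_contract_edge[OF less(2,1) uv] by (simp add: xs)
    then show ?thesis
      using is_minor_step[OF minor_step.contract[OF uv]] by blast
  qed
qed

definition clique :: "'v sgraph \<Rightarrow> 'v set \<Rightarrow> bool" where
  "clique G K \<longleftrightarrow> K \<subseteq> verts G \<and> (\<forall>x\<in>K. \<forall>y\<in>K. x \<noteq> y \<longrightarrow> {x, y} \<in> edges G)"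

lemma clique_minor:
  assumes "simple_graph G" "connected_graph G" "clique G K" "K \<noteq> {}"
  shows "is_minor (complete_graph (card K)) G"
proof -
  have K: "finite K" "K \<subseteq> verts G"
    using assms(1,3) finite_subset by (auto simp: clique_def simple_graph_def)
  then obtain f where f: "bij_betw f {..<card K} K"
    using ex_bij_betw_nat_finite by (metis atLeast0LessThan)
  show ?thesis
  proof (rule is_minor_embedding[where f = f])
    show "inj_on f (verts (complete_graph (card K)))" "f ` verts (complete_graph (card K)) \<subseteq> verts G"
      using f K by (auto simp: complete_graph_def bij_betw_def)
    show "verts (complete_graph (card K)) \<noteq> {}"
      using K(1) assms(4) by (simp add: complete_graph_def lessThan_empty_iff)
    fix e assume "e \<in> edges (complete_graph (card K))"
    then obtain i j where ij: "e = {i, j}" "i \<noteq> j" "i \<in> {..<card K}" "j \<in> {..<card K}"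
      by (auto simp: complete_graph_def card_2_iff)
    then have "f i \<noteq> f j" "f i \<in> K" "f j \<in> K"
      using f by (auto simp: bij_betw_def inj_on_def)
    then show "f ` e \<in> edges G"
      using assms(3) ij(1) by (simp add: clique_def)
  qed (use assms(1,2) simple_graph_complete_graph in auto)
qed

section \<open>Cut vertices, ears and the shape of blocks\<close>

definition separation :: "'v sgraph \<Rightarrow> 'v set \<Rightarrow> 'v set \<Rightarrow> 'v \<Rightarrow> bool" where
  "separation G U W v \<longleftrightarrow> U \<union> W = verts G \<and> U \<inter> W = {v} \<and> U \<noteq> {v} \<and> W \<noteq> {v} \<and>
     (\<forall>e\<in>edges G. e \<subseteq> U \<or> e \<subseteq> W)"

text \<open>\<open>ps\<close> lists the interior vertices only. Chords are excluded by
  \<open>ps \<noteq> []\<close>: an ear always brings a vertex outside \<open>S\<close>.\<close>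

definition ear :: "'v sgraph \<Rightarrow> 'v set \<Rightarrow> 'v \<Rightarrow> 'v list \<Rightarrow> 'v \<Rightarrow> bool" where
  "ear G S u ps u' \<longleftrightarrow> u \<in> S \<and> u' \<in> S \<and> u \<noteq> u' \<and> ps \<noteq> [] \<and> distinct ps \<and> set ps \<inter> S = {} \<and>
     successively (\<lambda>x y. {x, y} \<in> edges G) ps \<and> {u, hd ps} \<in> edges G \<and> {last ps, u'} \<in> edges G"

lemma ear_rev: "ear G S u ps u' \<Longrightarrow> ear G S u' (rev ps) u"
  unfolding ear_def by (auto simp: hd_rev last_rev insert_commute)

lemma ear_cycle:
  assumes "ear G S u ps u'" "distinct qs" "set qs \<subseteq> S" "qs \<noteq> []" "hd qs = u'" "last qs = u"
    "successively (\<lambda>x y. {x, y} \<in> edges G) qs"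
  shows "cycle_list (edges G) (ps @ qs)"
  using assms unfolding ear_def cycle_list_def by (auto simp: successively_append_iff)

text \<open>Let \<open>T\<close> be what is reachable outside \<open>S\<close> from an end of a
  boundary edge at \<open>u\<close>. If \<open>T\<close> had no edge to another vertex of
  \<open>S\<close>, then \<open>u\<close> would be a cut vertex; two distinct vertices of
  \<open>S\<close> ensure that the far side is not just \<open>{u}\<close>.\<close>

lemma ear_exists:
  assumes G: "simple_graph G" "connected_graph G" and nosep: "\<nexists>U W v. separation G U W v"
    and S: "S \<subseteq> verts G" "S \<noteq> verts G" "p \<in> S" "q \<in> S" "p \<noteq> q"
  obtains u ps u' where "ear G S u ps u'"
proof -
  obtain u x where ux: "u \<in> S" "x \<in> verts G - S" "{u, x} \<in> edges G"
    using boundary_edge[OF G(2,1) S(1) _ S(2)] S(3) by blast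
  define path where "path ps y \<longleftrightarrow> ps \<noteq> [] \<and> distinct ps \<and> set ps \<subseteq> verts G - S \<and> hd ps = x \<and> last ps = y \<and>
      successively (\<lambda>x y. {x, y} \<in> edges G) ps" for ps y
  define T where "T = {y. \<exists>ps. path ps y}"
  have "path [x] x"
    using ux by (simp add: path_def)
  then have "x \<in> T" unfolding T_def by blast
  have T: "T \<subseteq> verts G - S"
    by (auto simp: T_def path_def) (use last_in_set in \<open>blast+\<close>)
  have step: "z \<in> T" if "y \<in> T" "{y, z} \<in> edges G" "z \<in> verts G - S" for y z
  proof -
    obtain ps where ps: "path ps y"
      using \<open>y \<in> T\<close> T_def by blast
    show ?thesis
    proof (cases "z \<in> set ps")
      case True
      then obtain qs rs where "ps = qs @ z # rs"
        by (meson split_list)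
      then have "path (qs @ [z]) z"
        using ps by (auto simp: path_def successively_append_iff hd_append split: if_splits)
      then show ?thesis unfolding T_def by blast
    next
      case False
      then have "path (ps @ [z]) z"
        using ps that by (auto simp: path_def successively_append_iff)
      then show ?thesis unfolding T_def by blast
    qed
  qed
  have "\<exists>y u'. y \<in> T \<and> u' \<in> S - {u} \<and> {y, u'} \<in> edges G"
  proof (rule ccontr)
    assume none: "\<not> ?thesis"
    have nT: "z \<in> T \<or> z = u" if "y \<in> T" "{y, z} \<in> edges G" for y z
      using step[OF that] none that simple_graph_edgeD[OF G(1) that(2)] by blast
    have "separation G (insert u T) (verts G - T) u"
      unfolding separation_def
    proof (intro conjI ballI)
      show "insert u T \<union> (verts G - T) = verts G" "insert u T \<inter> (verts G - T) = {u}"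
        using T ux S(1) by auto
      show "insert u T \<noteq> {u}"
        using \<open>x \<in> T\<close> ux by blast
      show "verts G - T \<noteq> {u}"
      proof
        assume "verts G - T = {u}"
        moreover have "p \<in> verts G - T" "q \<in> verts G - T"
          using S T by auto
        ultimately show False using S(5) by simp
      qed
      fix e assume e: "e \<in> edges G"
      then obtain y z where yz: "e = {y, z}" "y \<in> verts G" "z \<in> verts G"
        using G(1) unfolding simple_graph_def by (metis card_2_iff insert_subset)
      show "e \<subseteq> insert u T \<or> e \<subseteq> verts G - T"
        using nT[of y z] nT[of z y] e yz by (auto simp: insert_commute)
    qed
    then show False using nosep by blast
  qed
  then obtain y u' ps where "path ps y" "u' \<in> S" "u' \<noteq> u" "{y, u'} \<in> edges G"
    unfolding T_def by blast
  then have "ear G S u ps u'"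
    using ux by (auto simp: ear_def path_def)
  then show ?thesis by (rule that)
qed

lemma book_edges:
  assumes "simple_graph G" "verts G = insert p (insert q C)" "p \<notin> C" "q \<notin> C"
    and "\<And>c. c \<in> C \<Longrightarrow> {p, c} \<in> edges G \<and> {q, c} \<in> edges G"
    and "\<And>c c'. \<lbrakk>c \<in> C; c' \<in> C\<rbrakk> \<Longrightarrow> {c, c'} \<notin> edges G"
  shows "edges G - {{p, q}} = (\<lambda>c. {p, c}) ` C \<union> (\<lambda>c. {q, c}) ` C"
proof (intro equalityI subsetI)
  fix e assume e: "e \<in> edges G - {{p, q}}"
  then obtain y z where yz: "e = {y, z}" "y \<in> verts G" "z \<in> verts G" "y \<noteq> z"
    using assms(1) unfolding simple_graph_def by (metis DiffD1 card_2_iff insert_subset)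
  show "e \<in> (\<lambda>c. {p, c}) ` C \<union> (\<lambda>c. {q, c}) ` C"
    using e yz assms(2) assms(6)[of y z] by (auto simp: insert_commute)
qed (use assms(3-5) in \<open>auto simp: doubleton_eq_iff\<close>)

text \<open>A set of at least two vertices without ears is the whole graph. Each ear is closed to a
  cycle inside the candidate set, and the bound on cycle lengths leaves room for very short ears
  only.\<close>

lemma book_graph:
  assumes G: "simple_graph G" "connected_graph G" and nosep: "\<nexists>U W v. separation G U W v"
    and short: "\<forall>xs. cycle_list (edges G) xs \<longrightarrow> length xs < 5"
    and noK4: "\<nexists>K. clique G K \<and> card K = 4"
    and "a \<in> verts G" "verts G \<noteq> {a}"
  obtains p q C where "p \<noteq> q" "verts G = insert p (insert q C)" "p \<notin> C" "q \<notin> C"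
    "edges G - {{p, q}} = (\<lambda>c. {p, c}) ` C \<union> (\<lambda>c. {q, c}) ` C" "{p, q} \<in> edges G \<or> C \<noteq> {}"
proof -
  have fin: "finite (verts G)"
    using G(1) by (simp add: simple_graph_def)
  have irrefl: "{x, x} \<notin> edges G" for x
    using simple_graph_edgeD(3)[OF G(1), of x x] by blast
  define N where "N p q = {c. {p, c} \<in> edges G \<and> {q, c} \<in> edges G}" for p q
  have N: "N p q \<subseteq> verts G" "p \<notin> N p q" "q \<notin> N p q" "N q p = N p q" for p q
    unfolding N_def using irrefl simple_graph_edgeD[OF G(1)] by blast+
  then have finN: "finite (N p q)" for p q
    using fin finite_subset by blast
  have NE: "{p, c} \<in> edges G" "{c, p} \<in> edges G" "{q, c} \<in> edges G" "{c, q} \<in> edges G"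
    if "c \<in> N p q" for p q c
    using that by (auto simp: N_def insert_commute)
  have Nne: "p \<noteq> c" "c \<noteq> p" "q \<noteq> c" "c \<noteq> q" if "c \<in> N p q" for p q c
    using that N(2,3) by blast+
  have two: "card (N p q) \<ge> 2" if "x \<in> N p q" "y \<in> N p q" "x \<noteq> y" for p q x y
    using card_mono[OF finN, of "{x, y}" p q] that by simp
  show ?thesis
  \<comment> \<open>Two common neighbours of distinct vertices amount to a 4-cycle.\<close>
  proof (cases "\<exists>p\<in>verts G. \<exists>q\<in>verts G. p \<noteq> q \<and> card (N p q) \<ge> 2")
    case True
    then obtain p0 q0 where pq0: "p0 \<in> verts G" "q0 \<in> verts G" "p0 \<noteq> q0" "card (N p0 q0) \<ge> 2"
      by blast
    define P where "P z \<longleftrightarrow> fst z \<noteq> snd z \<and> fst z \<in> verts G \<and> snd z \<in> verts G" for z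
    have "P (p0, q0)"
      using pq0 by (simp add: P_def)
    moreover have "\<forall>z. P z \<longrightarrow> card (N (fst z) (snd z)) < Suc (card (verts G))"
      using N(1) fin by (simp add: card_mono less_Suc_eq_le)
    \<comment> \<open>A maximal number of common neighbours selects the right diagonal of a 4-cycle;
      this is used against ears between two pages.\<close>
    ultimately obtain pq where "P pq" and mx: "\<forall>z. P z \<longrightarrow> card (N (fst z) (snd z)) \<le> card (N (fst pq)
        (snd pq))"
      using ex_has_greatest_nat[of P "(p0, q0)" "\<lambda>z. card (N (fst z) (snd z))"] by blast
    define p q where "p = fst pq" and "q = snd pq"
    have pq: "p \<in> verts G" "q \<in> verts G" "p \<noteq> q"
      using \<open>P pq\<close> by (simp_all add: P_def p_def q_def)
    have mx: "card (N x y) \<le> card (N p q)" if "x \<noteq> y" "x \<in> verts G" "y \<in> verts G" for x y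
      using mx[rule_format, of "(x, y)"] that by (simp add: P_def p_def q_def)
    have "card (N p q) \<ge> 2"
      using mx[of p0 q0] pq0 by simp
    then obtain A where "A \<subseteq> N p q" "card A = 2"
      by (meson obtain_subset_with_card_n)
    then obtain c1 c2 where c: "c1 \<in> N p q" "c2 \<in> N p q" "c1 \<noteq> c2"
      by (auto simp: card_2_iff)
    define S where "S = insert p (insert q (N p q))"
    \<comment> \<open>Closing through one page adds three vertices, so the ear has a single inner
      vertex, which would be a further page.\<close>
    have pole: "\<not> ear G S x ps y" if "{x, y} = {p, q}" for x ps y
    proof
      assume e: "ear G S x ps y"
      have Nxy: "N x y = N p q" "x \<noteq> y"
        using that N(4) pq(3) by (auto simp: doubleton_eq_iff)
      have "cycle_list (edges G) (ps @ [y, c1, x])"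
      proof (intro ear_cycle[OF e])
        have c1: "c1 \<in> N x y" "c1 \<in> S"
          using c Nxy by (auto simp: S_def)
        show "set [y, c1, x] \<subseteq> S"
          using e c1 by (auto simp: ear_def)
      qed (use NE[of c1 x y] Nne[of c1 x y] c Nxy in auto)
      from short[rule_format, OF this] have "length ps < 2" by simp
      moreover have "ps \<noteq> []"
        using e by (simp add: ear_def)
      ultimately obtain z where "ps = [z]"
        by (cases ps) (auto simp: Suc_less_eq2 less_Suc_eq)
      then have "z \<in> N x y" "z \<notin> S"
        using e by (auto simp: ear_def N_def insert_commute)
      then show False using Nxy by (simp add: S_def)
    qed
    \<comment> \<open>Closing through the other pole and a second page adds four vertices, already
      too many for any ear.\<close>
    have mixed: "\<not> ear G S x ps c" if "x \<in> {p, q}" "c \<in> N p q" for x ps c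
    proof
      assume e: "ear G S x ps c"
      obtain y where y: "{x, y} = {p, q}"
        using \<open>x \<in> {p, q}\<close> by auto
      obtain c' where c': "c' \<in> N p q" "c' \<noteq> c"
        using c by metis
      have Nxy: "N x y = N p q" "x \<noteq> y"
        using y N(4) pq(3) by (auto simp: doubleton_eq_iff)
      have "y \<in> S"
        using y by (auto simp: S_def doubleton_eq_iff)
      have "cycle_list (edges G) (ps @ [c, y, c', x])"
      proof (intro ear_cycle[OF e])
        show "set [c, y, c', x] \<subseteq> S"
          using e c' \<open>y \<in> S\<close> by (auto simp: ear_def S_def)
      qed (use NE[of c x y] NE[of c' x y] Nne[of c x y] Nne[of c' x y] that c' Nxy in auto)
      from short[rule_format, OF this] e show False
        by (simp add: ear_def)
    qed
    \<comment> \<open>With a third page the closing path has five vertices. With only two pages the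
      ear is a single vertex \<open>z\<close>, and then \<open>c\<close> and \<open>c'\<close> have
      the three common neighbours \<open>p\<close>, \<open>q\<close>, \<open>z\<close>, against
      maximality.\<close>
    have page: "\<not> ear G S c ps c'" if "c \<in> N p q" "c' \<in> N p q" for c ps c'
    proof
      assume e: "ear G S c ps c'"
      then have "c \<noteq> c'" "ps \<noteq> []" by (auto simp: ear_def)
      have adj: "{c', q} \<in> edges G" "{q, c'} \<in> edges G" "{c', p} \<in> edges G" "{p, c'} \<in> edges G"
        "{c, q} \<in> edges G" "{q, c} \<in> edges G" "{c, p} \<in> edges G" "{p, c} \<in> edges G"
        using that by (auto simp: N_def insert_commute)
      have inS: "c \<in> S" "c' \<in> S" "p \<in> S" "q \<in> S"
        using that by (auto simp: S_def)
      have ne: "p \<noteq> c" "p \<noteq> c'" "q \<noteq> c" "q \<noteq> c'"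
        using that N by blast+
      show False
      proof (cases "\<exists>d\<in>N p q. d \<noteq> c \<and> d \<noteq> c'")
        case True
        then obtain d where d: "d \<in> N p q" "d \<noteq> c" "d \<noteq> c'" by blast
        then have "{q, d} \<in> edges G" "{d, p} \<in> edges G" "d \<in> S" "d \<noteq> p" "d \<noteq> q"
          using NE[of d p q] Nne[of d p q] by (auto simp: S_def)
        then have "cycle_list (edges G) (ps @ [c', q, d, p, c])"
          using adj inS ne d pq \<open>c \<noteq> c'\<close> by (intro ear_cycle[OF e]) auto
        from short[rule_format, OF this] show False by simp
      next
        case False
        have "cycle_list (edges G) (ps @ [c', p, c])"
          using adj inS ne \<open>c \<noteq> c'\<close> by (intro ear_cycle[OF e]) auto
        from short[rule_format, OF this] obtain z where "ps = [z]"
          using \<open>ps \<noteq> []\<close> by (cases ps) (auto simp: Suc_less_eq2 less_Suc_eq)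
        then have z: "{c, z} \<in> edges G" "{z, c'} \<in> edges G" "z \<notin> S"
          using e by (auto simp: ear_def)
        then have "{p, q, z} \<subseteq> N c c'"
          using adj by (auto simp: N_def insert_commute)
        moreover have "card {p, q, z} = 3"
          using z(3) pq by (auto simp: S_def card_insert_if)
        ultimately have "3 \<le> card (N c c')"
          using card_mono[OF finN] by metis
        moreover have "N p q = {c, c'}"
          using False that by blast
        then have "card (N p q) \<le> 2"
          by (simp add: card_insert_if)
        moreover have "c \<in> verts G" "c' \<in> verts G"
          using N(1) that by blast+
        ultimately show False
          using mx[OF \<open>c \<noteq> c'\<close>] by force
      qed
    qed
    have "\<not> ear G S x ps y" for x ps y
    proof
      assume e: "ear G S x ps y"
      then have xy: "x \<in> S" "y \<in> S" "x \<noteq> y" by (auto simp: ear_def)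
      then consider "{x, y} = {p, q}" | "x \<in> {p, q}" "y \<in> N p q" | "x \<in> N p q"
          "y \<in> {p, q}" | "x \<in> N p q" "y \<in> N p q"
        unfolding S_def by fast
      then show False
      proof cases
        case 1
        then show False using pole e by blast
      next
        case 2
        then show False using mixed e by blast
      next
        case 3
        then show False using mixed ear_rev[OF e] by blast
      next
        case 4
        then show False using page e by blast
      qed
    qed
    moreover have S: "S \<subseteq> verts G" "p \<in> S" "q \<in> S"
      using pq N(1) by (auto simp: S_def)
    ultimately have V: "verts G = S"
      using ear_exists[OF G nosep S(1) _ S(2,3) pq(3)] by blast
    show ?thesis
    proof (cases "\<exists>d\<in>N p q. \<exists>d'\<in>N p q. {d, d'} \<in> edges G")
      case False
      then have "edges G - {{p, q}} = (\<lambda>c. {p, c}) ` N p q \<union> (\<lambda>c. {q, c}) ` N p q"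
        using V[unfolded S_def] by (intro book_edges[OF G(1)] N(2,3)) (auto intro: NE)
      then show ?thesis
        using V[unfolded S_def] c(1) pq(3) N(2,3) by (intro that[of p q "N p q"]) blast+
    next
      case True
      \<comment> \<open>Adjacent pages exclude a third page by a 5-cycle, and adjacent poles by
        \<open>K_4\<close>. What remains is \<open>K_4\<close> minus the edge \<open>pq\<close>,
        which becomes a book after exchanging poles and pages.\<close>
      then obtain d d' where d: "d \<in> N p q" "d' \<in> N p q" "{d, d'} \<in> edges G" by blast
      then have "d \<noteq> d'" using irrefl by blast
      have adj: "{d, p} \<in> edges G" "{d, q} \<in> edges G" "{d', p} \<in> edges G" "{d', q} \<in> edges G"
        "{p, d} \<in> edges G" "{q, d} \<in> edges G" "{p, d'} \<in> edges G" "{q, d'} \<in> edges G"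
        using d by (auto simp: N_def insert_commute)
      have ne: "p \<noteq> d" "p \<noteq> d'" "q \<noteq> d" "q \<noteq> d'"
        using d N by blast+
      have "x \<in> {d, d'}" if x: "x \<in> N p q" for x
      proof (rule ccontr)
        assume "x \<notin> {d, d'}"
        then have "cycle_list (edges G) [d, d', q, x, p]"
          using d x adj ne NE[OF x] Nne[OF x] pq \<open>d \<noteq> d'\<close> by (auto simp: cycle_list_def)
        from short[rule_format, OF this] show False by simp
      qed
      then have Npq: "N p q = {d, d'}" using d by blast
      have npq: "{p, q} \<notin> edges G"
      proof
        assume "{p, q} \<in> edges G"
        then have "clique G {p, q, d, d'}"
          using adj d pq V by (auto simp: clique_def S_def insert_commute)
        moreover have "card {p, q, d, d'} = 4"
          using ne pq \<open>d \<noteq> d'\<close> by (simp add: card_insert_if)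
        ultimately show False using noK4 by blast
      qed
      have "edges G - {{d, d'}} = (\<lambda>c. {d, c}) ` {p, q} \<union> (\<lambda>c. {d', c}) ` {p, q}"
        using adj ne npq irrefl V by (intro book_edges[OF G(1)]) (auto simp: S_def Npq insert_commute)
      then show ?thesis
        using V Npq ne \<open>d \<noteq> d'\<close> by (intro that[of d d' "{p, q}"]) (auto simp: S_def)
    qed
  next
    case False
    \<comment> \<open>Without 4-cycles only a single edge or a triangle can occur.\<close>
    have noC4: "x = y" if "p \<noteq> q" "x \<in> N p q" "y \<in> N p q" for p q x y
    proof -
      have "p \<in> verts G" "q \<in> verts G"
        using that simple_graph_edgeD[OF G(1)] unfolding N_def by blast+
      then show ?thesis
        using False two[OF that(2,3)] that(1) by blast
    qed
    obtain b where b: "{a, b} \<in> edges G"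
      using boundary_edge[OF G(2,1), of "{a}"] assms(6,7) by auto
    then have ab: "b \<in> verts G" "a \<noteq> b"
      using simple_graph_edgeD[OF G(1) b] by auto
    show ?thesis
    proof (cases "verts G = {a, b}")
      case True
      then show ?thesis
        using ab b book_edges[OF G(1), of a b "{}"] by (intro that[of a b "{}"]) auto
    next
      case more: False
      obtain u ps v where e: "ear G {a, b} u ps v"
        using ear_exists[OF G nosep _ _ _ _ ab(2), of "{a, b}"] more ab assms(6) by auto
      have uv: "{u, v} = {a, b}" "u \<noteq> v"
        using e by (auto simp: ear_def)
      then have uvE: "{u, v} \<in> edges G" "{v, u} \<in> edges G"
        using b by (auto simp: insert_commute)
      have "cycle_list (edges G) (ps @ [v, u])"
        using uv uvE by (intro ear_cycle[OF e]) auto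
      from short[rule_format, OF this] e consider x where "ps = [x]" | x y where "ps = [x, y]"
        by (cases ps; cases "tl ps") (auto simp: ear_def)
      then obtain x where x: "{u, x} \<in> edges G" "{v, x} \<in> edges G"
      proof cases
        case 1
        then show ?thesis
          using e by (intro that[of x]) (auto simp: ear_def insert_commute)
      next
        case 2
        then have "x \<in> N u y" "v \<in> N u y" "x \<noteq> v" "u \<noteq> y"
          using e uvE by (auto simp: ear_def N_def insert_commute)
        then show ?thesis
          using noC4 by blast
      qed
      then have xne: "x \<noteq> u" "x \<noteq> v" "x \<in> verts G" and xE: "{x, u} \<in> edges G" "{x, v} \<in> edges G"
        using simple_graph_edgeD[OF G(1)] irrefl by (auto simp: insert_commute)
      \<comment> \<open>A cycle closed through all three vertices of the triangle forces an ear with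
        one inner vertex, which together with \<open>r\<close> gives a 4-cycle.\<close>
      have V: "verts G = {u, v, x}"
      proof (rule ccontr)
        assume "verts G \<noteq> {u, v, x}"
        moreover have "{u, v, x} \<subseteq> verts G"
          using xne uvE simple_graph_edgeD[OF G(1)] by blast
        ultimately obtain s qs t where e: "ear G {u, v, x} s qs t"
          using ear_exists[OF G nosep, of "{u, v, x}" u v] uv(2) by auto
        then have st: "s \<in> {u, v, x}" "t \<in> {u, v, x}" "s \<noteq> t" by (auto simp: ear_def)
        obtain r where r: "r \<in> {u, v, x}" "r \<noteq> s" "r \<noteq> t"
          using st uv(2) xne by (metis insertCI)
        have adj: "{y, z} \<in> edges G" if "y \<in> {u, v, x}" "z \<in> {u, v, x}" "y \<noteq> z" for y z
          using that uvE x xE by auto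
        have "cycle_list (edges G) (qs @ [t, r, s])"
          using adj st r by (intro ear_cycle[OF e]) auto
        from short[rule_format, OF this] obtain y where "qs = [y]"
          using e by (cases qs) (auto simp: ear_def Suc_less_eq2 less_Suc_eq)
        then have "y \<in> N s t" "r \<in> N s t" "y \<noteq> r"
          using e r adj st by (auto simp: ear_def N_def insert_commute)
        then show False
          using noC4 st by blast
      qed
      have "edges G - {{u, v}} = (\<lambda>c. {u, c}) ` {x} \<union> (\<lambda>c. {v, c}) ` {x}"
        using V xne x irrefl by (intro book_edges[OF G(1)]) auto
      then show ?thesis
        using V xne uv by (intro that[of u v "{x}"]) auto
    qed
  qed
qed

section \<open>Cut ideals\<close>

lemma cut_equiv_image:
  assumes "\<And>e. e \<in> E \<Longrightarrow> e \<subseteq> U"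
  shows "cut_equiv E (image_mset (\<lambda>B. B \<inter> U) M) (image_mset (\<lambda>B. B \<inter> U) N) \<longleftrightarrow> cut_equiv E M N"
proof -
  have "size {#B \<in># image_mset (\<lambda>B. B \<inter> U) P. card (B \<inter> e) = 1#} = size {#B \<in># P. card (B \<inter> e) = 1#}"
    if "e \<in> E" for e and P :: "'a set multiset"
  proof -
    have "B \<inter> U \<inter> e = B \<inter> e" for B
      using assms[OF that] by blast
    then show ?thesis by (simp add: filter_mset_image_mset)
  qed
  then show ?thesis by (simp add: cut_equiv_def)
qed

text \<open>With the glue vertex as root of both parts, the traces of a cut on the two parts can be
  chosen independently. Each edge lies in one part, so equivalence splits into equivalence of the
  traces: this is the Segre product.\<close>

lemma quad_confluent_glue:
  assumes UW: "U \<inter> W = {v}" and fin: "finite (U \<union> W)"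
    and E: "E = E1 \<union> E2" "\<And>e. e \<in> E1 \<Longrightarrow> e \<subseteq> U" "\<And>e. e \<in> E2 \<Longrightarrow> e \<subseteq> W"
    and U: "quad_confluent (Pow (U - {v})) (cut_equiv E1)"
    and W: "quad_confluent (Pow (W - {v})) (cut_equiv E2)"
  shows "quad_confluent (Pow (U \<union> W - {v})) (cut_equiv E)"
proof (rule quad_confluent_bij[OF quad_confluent_Times[OF U W]])
  show "bij_betw (\<lambda>B. (B \<inter> U, B \<inter> W)) (Pow (U \<union> W - {v})) (Pow (U - {v}) \<times> Pow (W - {v}))"
    by (rule bij_betw_byWitness[where f' = "\<lambda>(A, B). A \<union> B"]) (use UW in auto)
  fix M N
  have "cut_equiv E M N \<longleftrightarrow> cut_equiv E1 M N \<and> cut_equiv E2 M N"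
    unfolding cut_equiv_def E(1) by blast
  also have "\<dots> \<longleftrightarrow> cut_equiv E1 (image_mset (\<lambda>B. B \<inter> U) M) (image_mset (\<lambda>B. B \<inter> U) N) \<and>
      cut_equiv E2 (image_mset (\<lambda>B. B \<inter> W) M) (image_mset (\<lambda>B. B \<inter> W) N)"
    using E by (simp add: cut_equiv_image)
  finally show "cut_equiv E M N \<longleftrightarrow>
     cut_equiv E1 (image_mset fst (image_mset (\<lambda>B. (B \<inter> U, B \<inter> W)) M))
         (image_mset fst (image_mset (\<lambda>B. (B \<inter> U, B \<inter> W)) N)) \<and>
     cut_equiv E2 (image_mset snd (image_mset (\<lambda>B. (B \<inter> U, B \<inter> W)) M))
         (image_mset snd (image_mset (\<lambda>B. (B \<inter> U, B \<inter> W)) N))"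
    by (simp add: multiset.map_comp comp_def)
qed (use fin in \<open>auto simp: cut_equiv_def\<close>)

lemma card_Diff_Int_edge:
  assumes "e \<subseteq> V" "card e = 2"
  shows "card ((V - B) \<inter> e) = 1 \<longleftrightarrow> card (B \<inter> e) = 1"
proof -
  obtain x y where "e = {x, y}" "x \<noteq> y"
    using assms(2) by (auto simp: card_2_iff)
  then show ?thesis
    using assms(1) unfolding \<open>e = {x, y}\<close> card_Int_pair[OF \<open>x \<noteq> y\<close>] by auto
qed

text \<open>The other side of a cut cuts the same edges. Gluing and the block result deliver a glue
  vertex or a pole as root, whereas the induction needs any vertex.\<close>

lemma quad_confluent_root:
  assumes "a \<in> V" "b \<in> V" "\<And>e. e \<in> E \<Longrightarrow> e \<subseteq> V \<and> card e = 2"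
    and "quad_confluent (Pow (V - {a})) (cut_equiv E)"
  shows "quad_confluent (Pow (V - {b})) (cut_equiv E)"
proof (rule quad_confluent_bij[OF assms(4)])
  let ?g = "\<lambda>B. if a \<in> B then V - B else B"
  show "bij_betw ?g (Pow (V - {b})) (Pow (V - {a}))"
    by (rule bij_betw_byWitness[where f' = "\<lambda>B. if b \<in> B then V - B else B"])
      (use assms(1,2) in \<open>auto simp: double_diff\<close>)
  fix M N :: "'a set multiset"
  have "card (?g B \<inter> e) = 1 \<longleftrightarrow> card (B \<inter> e) = 1" if "e \<in> E" for B e
    using card_Diff_Int_edge[of e V B] assms(3)[OF that] by auto
  then show "cut_equiv E M N \<longleftrightarrow> cut_equiv E (image_mset ?g M) (image_mset ?g N)"
    by (simp add: cut_equiv_def filter_mset_image_mset del: One_nat_def cong: filter_mset_cong)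
qed

text \<open>Collapsing the other side \<open>W\<close> to \<open>v\<close> retracts the graph onto
  \<open>U\<close> and sends each edge to an edge or to a point.\<close>

lemma connected_graph_separation:
  assumes G: "simple_graph G" "connected_graph G" and sep: "separation G U W v"
  shows "connected_graph \<lparr>verts = U, edges = {e \<in> edges G. e \<subseteq> U}\<rparr>"
    (is "connected_graph ?G")
proof -
  have UW: "U \<union> W = verts G" "U \<inter> W = {v}" "\<And>e. e \<in> edges G \<Longrightarrow> e \<subseteq> U \<or> e \<subseteq> W"
    using sep by (auto simp: separation_def)
  have step: "((if x \<in> U then x else v), (if y \<in> U then y else v)) \<in> {(x, y). {x, y} \<in> edges ?G}\<^sup>*"
    if "{x, y} \<in> edges G" for x y
  proof (cases "x \<in> U \<and> y \<in> U")
    case True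
    then show ?thesis using that by auto
  next
    case False
    then have "x \<in> W" "y \<in> W"
      using UW(3)[OF that] by auto
    then have "(if x \<in> U then x else v) = v" "(if y \<in> U then y else v) = v"
      using UW(2) by auto
    then show ?thesis by simp
  qed
  have "(x, y) \<in> {(x, y). {x, y} \<in> edges ?G}\<^sup>*" if "x \<in> U" "y \<in> U" for x y
  proof -
    have "x \<in> verts G" "y \<in> verts G"
      using that UW(1) by auto
    then have "(x, y) \<in> {(x, y). {x, y} \<in> edges G}\<^sup>*"
      using G(2) by (simp add: connected_graph_def)
    from rtrancl_map_rtrancl[OF this, of "\<lambda>x. if x \<in> U then x else v"] step that show ?thesis
      by simp
  qed
  moreover have "U \<noteq> {}"
    using UW(2) by auto
  ultimately show ?thesis
    by (simp add: connected_graph_def)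
qed

lemma separation_sym: "separation G U W v \<Longrightarrow> separation G W U v"
  unfolding separation_def by (simp add: Un_commute Int_commute) blast

lemma cycle_list_mono: "cycle_list E xs \<Longrightarrow> E \<subseteq> F \<Longrightarrow> cycle_list F xs"
  unfolding cycle_list_def by (auto elim: successively_mono)

text \<open>The minor hypotheses enter as bounds on cycles and cliques, because these pass to the
  two induced parts of a separation at once.\<close>

lemma quad_confluent_graph:
  assumes "simple_graph G" "connected_graph G"
    and "\<forall>xs. cycle_list (edges G) xs \<longrightarrow> length xs < 5"
    and "\<nexists>K. clique G K \<and> card K = 4"
    and "a \<in> verts G"
  shows "quad_confluent (Pow (verts G - {a})) (cut_equiv (edges G))"
  using assms
proof (induction "card (verts G)" arbitrary: G a rule: less_induct)
  case less
  note G = less.prems(1,2) and short = less.prems(3) and noK4 = less.prems(4) and a = less.prems(5)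
  have fin: "finite (verts G)" and E: "\<And>e. e \<in> edges G \<Longrightarrow> e \<subseteq> verts G \<and> card e = 2"
    using G(1) by (auto simp: simple_graph_def)
  show ?case
  proof (cases "\<exists>U W v. separation G U W v")
    case True
    then obtain U W v where sep: "separation G U W v" by blast
    have part: "quad_confluent (Pow (U - {v})) (cut_equiv {e \<in> edges G. e \<subseteq> U})"
      if sep: "separation G U W v" for U W
    proof -
      let ?G = "\<lparr>verts = U, edges = {e \<in> edges G. e \<subseteq> U}\<rparr>"
      have "U \<subset> verts G" "v \<in> U"
        using sep by (auto simp: separation_def)
      have "quad_confluent (Pow (verts ?G - {v})) (cut_equiv (edges ?G))"
      proof (rule less.hyps)
        show "card (verts ?G) < card (verts G)"
          using \<open>U \<subset> verts G\<close> fin by (simp add: psubset_card_mono)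
        show "simple_graph ?G"
          using E \<open>U \<subset> verts G\<close> fin finite_subset by (auto simp: simple_graph_def)
        show "connected_graph ?G"
          using connected_graph_separation[OF G sep] .
        show "\<forall>xs. cycle_list (edges ?G) xs \<longrightarrow> length xs < 5"
          using short cycle_list_mono[of "edges ?G" _ "edges G"] by auto
        have "clique G K" if "clique ?G K" for K
          using that \<open>U \<subset> verts G\<close> by (auto simp: clique_def)
        then show "\<nexists>K. clique ?G K \<and> card K = 4"
          using noK4 by blast
        show "v \<in> verts ?G"
          using \<open>v \<in> U\<close> by simp
      qed
      then show ?thesis by simp
    qed
    have UW: "U \<union> W = verts G" "U \<inter> W = {v}" "\<And>e. e \<in> edges G \<Longrightarrow> e \<subseteq> U \<or> e \<subseteq> W"
      using sep by (auto simp: separation_def)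
    have "quad_confluent (Pow (U \<union> W - {v})) (cut_equiv (edges G))"
      using part[OF sep] part[OF separation_sym[OF sep]] UW fin
      by (intro quad_confluent_glue[where ?E1.0 = "{e \<in> edges G. e \<subseteq> U}" and ?E2.0 = "{e \<in> edges G. e \<subseteq> W}"]) auto
    moreover have "v \<in> verts G"
      using UW by blast
    ultimately show ?thesis
      using quad_confluent_root[OF _ a E] UW(1) by metis
  next
    case nosep: False
    show ?thesis
    proof (cases "verts G = {a}")
      case True
      \<comment> \<open>For a single vertex \<open>{}\<close> is the only variable, so the size
        determines the monomial.\<close>
      have "M = replicate_mset (size M) {}" if "set_mset M \<subseteq> Pow {}" for M :: "'a set multiset"
        using that by (metis Pow_empty set_mset_subset_singletonD)
      then show ?thesis
        unfolding quad_confluent_def True cut_equiv_def by (metis Diff_cancel)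
    next
      case False
      obtain p q C where pqC: "p \<noteq> q" "verts G = insert p (insert q C)" "p \<notin> C" "q \<notin> C"
        "edges G - {{p, q}} = (\<lambda>c. {p, c}) ` C \<union> (\<lambda>c. {q, c}) ` C" "{p, q} \<in> edges G \<or> C \<noteq> {}"
        by (rule book_graph[OF G nosep short noK4 a False])
      have "finite C"
        using fin pqC(2) by simp
      then have "quad_confluent (Pow (insert q C)) (cut_equiv (edges G))"
        using quad_confluent_block[OF pqC(1,3,4) _ pqC(5,6)] by blast
      moreover have "insert q C = verts G - {p}"
        using pqC by auto
      ultimately have "quad_confluent (Pow (verts G - {p})) (cut_equiv (edges G))"
        by (simp only:)
      moreover have "p \<in> verts G"
        using pqC(2) by blast
      ultimately show ?thesis
        using quad_confluent_root[OF _ a E] by blast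
    qed
  qed
qed

section \<open>From rooted sets to unordered partitions\<close>

definition cut_mset_equiv :: "'v sgraph \<Rightarrow> 'v set set multiset \<Rightarrow> 'v set set multiset \<Rightarrow> bool" where
  "cut_mset_equiv G M N \<longleftrightarrow> size M = size N \<and>
     (\<forall>e\<in>edges G. size {#P \<in># M. e \<in> cut_edges G P#} = size {#P \<in># N. e \<in> cut_edges G P#})"

lemma quad_confluent_cuts:
  assumes G: "simple_graph G" and a: "a \<in> verts G"
    and "quad_confluent (Pow (verts G - {a})) (cut_equiv (edges G))"
  shows "quad_confluent (cuts G) (cut_mset_equiv G)"
proof (rule quad_confluent_bij[OF assms(3)])
  \<comment> \<open>Exactly one part of a cut avoids \<open>a\<close>; the union over this singleton
    extracts it.\<close>
  let ?g = "\<lambda>P. \<Union>{A \<in> P. a \<notin> A}"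
  have cut: "\<exists>A. A \<subseteq> verts G - {a} \<and> P = {A, verts G - A} \<and> ?g P = A" if "P \<in> cuts G" for P
  proof -
    obtain A B where AB: "P = {A, B}" "A \<inter> B = {}" "A \<union> B = verts G"
      using \<open>P \<in> cuts G\<close> unfolding cuts_def by blast
    obtain C where C: "C \<subseteq> verts G - {a}" "P = {C, verts G - C}"
    proof (cases "a \<in> A")
      case True
      show ?thesis by (rule that[of B]) (use True AB in auto)
    next
      case False
      show ?thesis by (rule that[of A]) (use False AB in auto)
    qed
    moreover have "{A \<in> P. a \<notin> A} = {C}"
      using C a by auto
    ultimately show ?thesis by auto
  qed
  show "bij_betw ?g (cuts G) (Pow (verts G - {a}))"
  proof (rule bij_betw_byWitness[where f' = "\<lambda>B. {B, verts G - B}"])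
    show "\<forall>P\<in>cuts G. {?g P, verts G - ?g P} = P"
    proof
      fix P assume "P \<in> cuts G"
      from cut[OF this] obtain A where A: "P = {A, verts G - A}" "?g P = A"
        by (elim exE conjE)
      show "{?g P, verts G - ?g P} = P"
        unfolding A(2) by (rule A(1)[symmetric])
    qed
    have mem: "{B, verts G - B} \<in> cuts G" if "B \<in> Pow (verts G - {a})" for B
      unfolding cuts_def mem_Collect_eq
      by (intro exI[of _ B] exI[of _ "verts G - B"]) (use that in auto)
    then show "(\<lambda>B. {B, verts G - B}) ` Pow (verts G - {a}) \<subseteq> cuts G"
      by blast
    show "\<forall>B\<in>Pow (verts G - {a}). ?g {B, verts G - B} = B"
    proof
      fix B assume "B \<in> Pow (verts G - {a})"
      then have "{A \<in> {B, verts G - B}. a \<notin> A} = {B}"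
        using a by auto
      then show "?g {B, verts G - B} = B" by simp
    qed
    show "?g ` cuts G \<subseteq> Pow (verts G - {a})"
    proof (intro image_subsetI PowI)
      fix P assume "P \<in> cuts G"
      from cut[OF this] show "?g P \<subseteq> verts G - {a}"
        by (elim exE conjE) (simp only:)
    qed
  qed
  have iff: "e \<in> cut_edges G P \<longleftrightarrow> card (?g P \<inter> e) = 1" if "P \<in> cuts G" "e \<in> edges G" for P e
  proof -
    obtain A where A: "P = {A, verts G - A}" "?g P = A"
      using cut[OF \<open>P \<in> cuts G\<close>] by blast
    have "e \<in> cut_edges G P \<longleftrightarrow> card (A \<inter> e) = 1 \<or> card ((verts G - A) \<inter> e) = 1"
      using that(2) unfolding cut_edges_def A(1) by blast
    also have "\<dots> \<longleftrightarrow> card (A \<inter> e) = 1"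
      using card_Diff_Int_edge[of e "verts G" A] that(2) G unfolding simple_graph_def by blast
    finally show ?thesis using A(2) by simp
  qed
  fix M N assume MN: "set_mset M \<subseteq> cuts G" "set_mset N \<subseteq> cuts G"
  have "size {#B \<in># image_mset ?g L. card (B \<inter> e) = 1#} = size {#P \<in># L. e \<in> cut_edges G P#}"
    if "set_mset L \<subseteq> cuts G" "e \<in> edges G" for L e
  proof -
    have "{#P \<in># L. e \<in> cut_edges G P#} = {#P \<in># L. card (?g P \<inter> e) = 1#}"
      using iff that by (intro filter_mset_cong) auto
    then show ?thesis by (simp only: filter_mset_image_mset size_image_mset)
  qed
  then show "cut_mset_equiv G M N \<longleftrightarrow> cut_equiv (edges G) (image_mset ?g M) (image_mset ?g N)"
    using MN by (simp add: cut_mset_equiv_def cut_equiv_def del: One_nat_def)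
qed

section \<open>The toric map on monomials and its kernel\<close>

definition cut_monomial :: "'v sgraph \<Rightarrow> 'v set set multiset \<Rightarrow> 'v st_var monomial" where
  "cut_monomial G M = (\<Sum>P\<in>#M. Poly_Mapping.single s_var 1
      + (\<Sum>e\<in>cut_edges G P. Poly_Mapping.single (t_var e) 1))"

lemma prod_single_monomial:
  "(\<Prod>x\<in>A. Poly_Mapping.single (f x) (1::'k::field)) = Poly_Mapping.single (\<Sum>x\<in>A. f x :: 'y monomial) 1"
  by (induction A rule: infinite_finite_induct) (auto simp: mult_single)

lemma cut_hom_eq:
  "cut_hom G (f :: ('v set set, 'k::field) mpoly) =
    (\<Sum>m\<in>Poly_Mapping.keys f. Poly_Mapping.single (cut_monomial G (mset_of m)) (Poly_Mapping.lookup f m))"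
proof -
  let ?\<phi> = "\<lambda>P. mpoly_var s_var * (\<Prod>e\<in>cut_edges G P. mpoly_var (t_var e)) :: ('v st_var, 'k) mpoly"
  have phi: "?\<phi> P = Poly_Mapping.single (Poly_Mapping.single s_var 1
      + (\<Sum>e\<in>cut_edges G P. Poly_Mapping.single (t_var e) 1)) 1" for P
    by (simp add: mpoly_var_def prod_single_monomial mult_single)
  have prod: "(\<Prod>P\<in>#M. ?\<phi> P) = Poly_Mapping.single (cut_monomial G M) 1" for M
    unfolding phi by (induction M) (auto simp: cut_monomial_def mult_single)
  have "(\<Prod>P\<in>Poly_Mapping.keys m. ?\<phi> P ^ Poly_Mapping.lookup m P)
      = Poly_Mapping.single (cut_monomial G (mset_of m)) 1" for m
    unfolding prod[symmetric] image_prod_mset_multiplicity by (simp add: set_mset_of count_mset_of)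
  then show ?thesis
    by (simp add: cut_hom_def mpoly_subst_def mult_single)
qed

text \<open>The exponent of \<open>s_var\<close> is the number of factors, and that of
  \<open>t_var e\<close> the number of factors whose cut contains \<open>e\<close>.\<close>

lemma cut_monomial_eq_iff:
  assumes "finite (edges G)"
  shows "cut_monomial G M = cut_monomial G N \<longleftrightarrow> cut_mset_equiv G M N"
proof -
  have fin: "finite (cut_edges G P)" for P
    using assms by (simp add: cut_edges_def)
  have s: "Poly_Mapping.lookup (cut_monomial G L) s_var = size L" for L
    by (induction L) (auto simp: cut_monomial_def lookup_add lookup_sum lookup_single)
  have t: "Poly_Mapping.lookup (cut_monomial G L) (t_var e) = size {#P \<in># L. e \<in> cut_edges G P#}" for L e
  proof (induction L)
    case (add P L)
    have "(\<Sum>e'\<in>cut_edges G P. Poly_Mapping.lookup (Poly_Mapping.single (t_var e') (1::nat)) (t_var e)) =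
        (\<Sum>e'\<in>cut_edges G P. if e = e' then 1 else 0)"
      by (rule sum.cong) (auto simp: lookup_single when_def)
    also have "\<dots> = (if e \<in> cut_edges G P then 1 else 0)"
      using fin by simp
    finally show ?case
      using add by (simp add: cut_monomial_def lookup_add lookup_sum lookup_single)
  qed (simp add: cut_monomial_def)
  have nonedge: "{#P \<in># L. e \<in> cut_edges G P#} = {#}" if "e \<notin> edges G" for L e
    using that by (auto simp: cut_edges_def)
  show ?thesis
  proof
    assume MN: "cut_mset_equiv G M N"
    have "Poly_Mapping.lookup (cut_monomial G M) x = Poly_Mapping.lookup (cut_monomial G N) x" for x
    proof (cases x)
      case s_var
      then show ?thesis using MN by (simp add: s cut_mset_equiv_def)
    next
      case (t_var e)
      show ?thesis
      proof (cases "e \<in> edges G")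
        case True
        then show ?thesis using MN t_var by (simp add: t cut_mset_equiv_def)
      next
        case False
        then show ?thesis by (simp only: t_var t nonedge[OF False])
      qed
    qed
    then show "cut_monomial G M = cut_monomial G N"
      by (rule poly_mapping_eqI)
  next
    assume "cut_monomial G M = cut_monomial G N"
    then show "cut_mset_equiv G M N"
      unfolding cut_mset_equiv_def by (metis s t)
  qed
qed

lemma finite_cuts: "finite (verts G) \<Longrightarrow> finite (cuts G)"
  by (rule finite_subset[of _ "Pow (Pow (verts G))"]) (auto simp: cuts_def)

theorem corollary2p4:
  fixes G :: "'v sgraph"
  assumes "simple_graph G"
    and "connected_graph G"
    and "\<not> is_minor (complete_graph 4) G"
    and "\<not> is_minor (cycle_graph 5) G"
  shows "\<exists>r. monomial_order (cuts G) r \<and>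
           (\<exists>B. groebner_basis (cuts G) r (cut_ideal G :: ('v set set, 'k::field) mpoly set) B \<and>
                (\<forall>g\<in>B. quadratic_binomial g))"
proof (rule quadratic_groebner_basis[where R = "cut_mset_equiv G"])
  obtain a where a: "a \<in> verts G"
    using assms(2) unfolding connected_graph_def by blast
  have "length xs < 5" if "cycle_list (edges G) xs" for xs
    using cycle_minor[OF assms(1,2) that, of 5] assms(4) by force
  moreover have "\<nexists>K. clique G K \<and> card K = 4"
    using clique_minor[OF assms(1,2)] assms(3) by (metis card.empty zero_neq_numeral)
  ultimately show "quad_confluent (cuts G) (cut_mset_equiv G)"
    by (intro quad_confluent_cuts[OF assms(1) a] quad_confluent_graph[OF assms(1,2) _ _ a]) blast+
  show "finite (cuts G)"
    using assms(1) by (simp add: finite_cuts simple_graph_def)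
  show "cut_mset_equiv G (L + M) (L + N)" if "cut_mset_equiv G M N" for L M N
    using that by (simp add: cut_mset_equiv_def)
  note mono_iff = cut_monomial_eq_iff[OF simple_graph_finite_edges[OF assms(1)]]
  have ideal: "cut_ideal G = {f :: ('v set set, 'k) mpoly. Poly_Mapping.keys f \<subseteq> monomials (cuts G)
      \<and> cut_hom G f = 0}"
    by (auto simp: cut_ideal_def a_kernel_def' mpoly_ring_def)
  show "Poly_Mapping.single (monomial_of M) 1 - Poly_Mapping.single (monomial_of N)
      1 \<in> (cut_ideal G :: ('v set set, 'k) mpoly set)"
    if "set_mset M \<subseteq> cuts G" "set_mset N \<subseteq> cuts G" "cut_mset_equiv G M N" for M N
  proof (cases "M = N")
    case True
    then show ?thesis by (simp add: ideal cut_hom_eq)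
  next
    case False
    then have neq: "monomial_of M \<noteq> monomial_of N"
      by (simp add: monomial_of_eq_iff)
    have "cut_monomial G M = cut_monomial G N"
      using that(3) mono_iff by blast
    then show ?thesis
      using neq that(1,2)
      by (simp add: ideal cut_hom_eq keys_binomial monomial_of_in_monomials lookup_minus lookup_single single_add[symmetric])
  qed
  show "Poly_Mapping.keys f \<subseteq> monomials (cuts G)" if "f \<in> cut_ideal G" for f :: "('v set set, 'k) mpoly"
    using that by (simp add: ideal)
  show "\<exists>n\<in>Poly_Mapping.keys f. n \<noteq> m \<and> cut_mset_equiv G (mset_of m) (mset_of n)"
    if f: "f \<in> cut_ideal G" and m: "m \<in> Poly_Mapping.keys f" for f :: "('v set set, 'k) mpoly" and m
  proof (rule ccontr)
    let ?\<mu> = "\<lambda>n. cut_monomial G (mset_of n)"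
    assume none: "\<not> ?thesis"
    have only: "?\<mu> n \<noteq> ?\<mu> m" if "n \<in> Poly_Mapping.keys f - {m}" for n
    proof
      assume "?\<mu> n = ?\<mu> m"
      then have "cut_mset_equiv G (mset_of m) (mset_of n)"
        using mono_iff[of "mset_of m" "mset_of n"] by simp
      then show False
        using that none by blast
    qed
    \<comment> \<open>Compare coefficients at the image of \<open>m\<close>: if no other monomial of
      \<open>f\<close> maps there, nothing can cancel the coefficient of \<open>m\<close>.\<close>
    have "0 = Poly_Mapping.lookup (cut_hom G f) (?\<mu> m)"
      using f by (simp add: ideal)
    also have "\<dots> = (\<Sum>n\<in>Poly_Mapping.keys f. Poly_Mapping.lookup f n when ?\<mu> n = ?\<mu> m)"
      by (simp add: cut_hom_eq lookup_sum lookup_single)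
    also have "\<dots> = Poly_Mapping.lookup f m + (\<Sum>n\<in>Poly_Mapping.keys f
        - {m}. Poly_Mapping.lookup f n when ?\<mu> n = ?\<mu> m)"
      using m by (subst sum.remove[of _ m]) auto
    also have "(\<Sum>n\<in>Poly_Mapping.keys f - {m}. Poly_Mapping.lookup f n when ?\<mu> n = ?\<mu> m) = 0"
      using only by (intro sum.neutral) (auto simp: when_def)
    finally show False
      using m by (simp add: in_keys_iff)
  qed
qed (auto simp: cut_mset_equiv_def)

end
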